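(* Let $f:[-\pi,\pi]\to\mathbb R$ be a real even continuous function which is positive and strictly monotone increasing on $[0,\pi]$. Then there exist an asymptotically uniform grid $\{\xi_{1,n},\xi_{2,n},\dots,\xi_{n,n}\}_n$ in $[0,\pi]$ and, for every $n$, orderings (with multiplicity) $\lambda_1(T_n(f)),\dots,\lambda_n(T_n(f))$ of the eigenvalues of $T_n(f)$ and $\lambda_1(H_n(f)),\dots,\lambda_n(H_n(f))$ of the eigenvalues of $H_n(f)$ such that $$\lambda_i(T_n(f))=f(\xi_{i,n}),\qquad \lambda_i(H_n(f))=(-1)^{i+1}\lambda_i(T_n(f)),$$ for all $i=1,\dots,n$.
   Context: For $f\in L^1(-\pi,\pi)$, with Fourier coefficients $\hat f_k=\frac1{2\pi}\int_{-\pi}^{\pi}f(\theta)e^{-\mathbf{i}k\theta}\,d\theta$, $k\in\mathbb Z$, $T_n(f)$ is the $n\times n$ Toeplitz matrix $(T_n(f))_{s,t}=\hat f_{s-t}$, $s,t=1,\dots,n$. $Y_n$ is the $n\times n$ flip matrix ($(Y_n)_{i,j}=1$ if $i+j=n+1$, $0$ otherwise), and $H_n(f)=Y_nT_n(f)$. A sequence of grids $\{\xi_{i,n}\}_{i=1,\dots,n}$ of points of $[a,b]$ is asymptotically uniform in $[a,b]$ if $\max_{i=1,\dots,n}\left|\xi_{i,n}-\left(a+i\,\frac{b-a}{n}\right)\right|\to0$ as $n\to\infty$. *)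

theory Defs
  imports "HOL-Analysis.Analysis" "Jordan_Normal_Form.Char_Poly"
begin

definition fourier_coeff :: "(real \<Rightarrow> complex) \<Rightarrow> int \<Rightarrow> complex" where
  "fourier_coeff f k = 1 / (2 * of_real pi) *
     (LINT \<theta>:{-pi..pi}|lebesgue. f \<theta> * exp (- \<i> * of_int k * of_real \<theta>))"

(* Jordan_Normal_Form matrices are indexed from 0. The difference s - t is not
   affected by the shift; in the flip matrix the 1-based indices are i + 1 and j + 1. *)

definition toeplitz_mat :: "nat \<Rightarrow> (real \<Rightarrow> complex) \<Rightarrow> complex mat" where
  "toeplitz_mat n f = Matrix.mat n n (\<lambda>(s, t). fourier_coeff f (int s - int t))"

definition flip_mat :: "nat \<Rightarrow> complex mat" where
  "flip_mat n = Matrix.mat n n (\<lambda>(i, j). if (i + 1) + (j + 1) = n + 1 then 1 else 0)"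

definition hankel_mat :: "nat \<Rightarrow> (real \<Rightarrow> complex) \<Rightarrow> complex mat" where
  "hankel_mat n f = flip_mat n * toeplitz_mat n f"

(* proots is the multiset of roots with multiplicity; only l 1, ..., l (dim_row A) matter. *)

definition eigenvalue_ordering :: "complex mat \<Rightarrow> (nat \<Rightarrow> complex) \<Rightarrow> bool" where
  "eigenvalue_ordering A l \<longleftrightarrow>
     image_mset l (mset_set {1..dim_row A}) = proots (char_poly A)"

(* The n-th grid is xi n 1, ..., xi n n; the value of the sequence at n = 0 is irrelevant. *)

definition asymptotically_uniform_grid :: "real \<Rightarrow> real \<Rightarrow> (nat \<Rightarrow> nat \<Rightarrow> real) \<Rightarrow> bool" where
  "asymptotically_uniform_grid a b xi \<longleftrightarrow>
     (\<forall>n\<ge>1. \<forall>i\<in>{1..n}. xi n i \<in> {a..b}) \<and>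
     (\<lambda>n. MAX i\<in>{1..n}. \<bar>xi n i - (a + real i * ((b - a) / real n))\<bar>) \<longlonglongrightarrow> 0"

end

theory Submission
  imports Defs
begin

text \<open>
  \<open>H\<^sub>n(f)\<close> is real symmetric and \<open>H\<^sub>n(f)\<^sup>2 = T\<^sub>n(f)\<^sup>2\<close> with \<open>T\<^sub>n(f)\<close> positive definite, so an
  orthonormal eigenbasis of \<open>H\<^sub>n(f)\<close> with eigenvalues \<open>d\<^sub>j\<close> also diagonalises \<open>T\<^sub>n(f)\<close> (eigenvalues
  \<open>\<bar>d\<^sub>j\<bar>\<close>) and the flip (eigenvalues \<open>sgn d\<^sub>j\<close>). The trace of the flip tells how many \<open>d\<^sub>j\<close> are positive;
  their absolute values in increasing order get the odd indices, those of the negative ones the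
  even indices.

  It remains to locate the eigenvalues inside each of the two classes. Approximate \<open>f\<close> by a
  polynomial \<open>q\<close> of degree \<open>m\<close> in \<open>cos\<close>. The quadratic form of \<open>T\<^sub>n(q)\<close> at \<open>v\<close> is the mean of \<open>q \<bar>V\<bar>\<^sup>2\<close>,
  where \<open>V\<close> is the trigonometric polynomial with coefficients \<open>v\<close>, and this mean is computed exactly by
  any uniform quadrature rule with \<open>2 N + 1 \<ge> n + m\<close> nodes. For symmetric or skew-symmetric \<open>v\<close>, a zero of
  \<open>V\<close> at a node implies one at the opposite node, so about half of the linear conditions
  suffice to make \<open>V\<close> vanish at all nodes where \<open>f\<close> is small (or large). Comparing dimensions bounds the
  number of small (or large) eigenvalues of a class by the number of such nodes.
\<close>

section \<open>Quadrature of trigonometric polynomials\<close>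

lemma integral_cis_int:
  "integral {-pi..pi} (\<lambda>x. cis (of_int l * x)) = (if l = 0 then of_real (2 * pi) else 0)"
proof (cases "l = 0")
  case True
  then show ?thesis
    by (simp flip: of_real_mult of_real_add add: scaleR_conv_of_real)
next
  case False
  let ?F = "\<lambda>x. cis (of_int l * x) / (\<i> * of_int l)"
  have "((\<lambda>x. cis (of_int l * x)) has_integral (?F pi - ?F (-pi))) {-pi..pi}"
  proof (rule fundamental_theorem_of_calculus)
    fix x assume "x \<in> {-pi..pi}"
    show "(?F has_vector_derivative cis (of_int l * x)) (at x within {-pi..pi})"
    proof -
      have "((\<lambda>z. exp (\<i> * of_int l * z) / (\<i> * of_int l)) has_field_derivative
          exp (\<i> * of_int l * of_real x)) (at (of_real x))"
        by (auto intro!: derivative_eq_intros simp: False)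
      from has_vector_derivative_real_field[OF this] show ?thesis
        by (simp add: cis_conv_exp mult.assoc)
    qed
  qed simp
  moreover have "cis (of_int l * pi) = cis (of_int l * (-pi))"
  proof -
    have "cis (of_int l * (-pi)) = cis (of_int l * pi) * cis (2 * pi * of_int (-l))"
      by (simp add: cis_mult algebra_simps)
    also have "cis (2 * pi * of_int (-l)) = 1"
      by (rule cis_multiple_2pi) simp
    finally show ?thesis by simp
  qed
  ultimately show ?thesis using False by (simp add: integral_unique)
qed

text \<open>Multiplying the sum by \<open>g 1\<close> shifts the index by one, and since
  \<open>g\<close> has period \<open>2 * N + 1\<close> the sum is reproduced. So it vanishes unless
  \<open>g 1 = 1\<close>, which would make \<open>l\<close> a multiple of \<open>2 * N + 1\<close>;
  the bound on \<open>l\<close> leaves only 0.\<close>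

lemma sum_roots_of_unity_symmetric:
  fixes N :: nat and l :: int
  assumes "\<bar>l\<bar> \<le> 2 * int N"
  shows "(\<Sum>j\<in>{-int N..int N}. cis (of_int l * (2 * pi * of_int j / (2 * real N + 1)))) =
    (if l = 0 then of_nat (2 * N + 1) else 0)"
proof (cases "l = 0")
  case True
  then show ?thesis by simp
next
  case False
  define M where "M = 2 * real N + 1"
  have M: "M > 0" by (simp add: M_def)
  define g where "g j = cis (of_int l * (2 * pi * of_int j / M))" for j :: int
  define S where "S = sum g {-int N..int N}"
  have step: "g (j + 1) = g 1 * g j" for j
    unfolding g_def cis_mult by (rule arg_cong[of _ _ cis]) (simp add: algebra_simps add_divide_distrib)
  have "g 1 * S = (\<Sum>j\<in>{-int N..int N}. g (j + 1))"
    by (simp add: S_def sum_distrib_left step)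
  also have "\<dots> = sum g {-int N + 1..int N + 1}"
    by (rule sum.reindex_bij_witness[of _ "\<lambda>j. j - 1" "\<lambda>j. j + 1"]) auto
  also have "\<dots> = sum g {-int N + 1..int N} + g (int N + 1)"
  proof -
    have "{-int N + 1..int N + 1} = insert (int N + 1) {-int N + 1..int N}" by auto
    then show ?thesis by simp
  qed
  also have "g (int N + 1) = g (- int N)"
  proof -
    have "g (int N + 1) = g (- int N) * cis (2 * pi * of_int l)"
      unfolding g_def cis_mult by (rule arg_cong[of _ _ cis]) (use M in \<open>simp add: field_simps M_def\<close>)
    also have "cis (2 * pi * of_int l) = 1" by (rule cis_multiple_2pi) simp
    finally show ?thesis by simp
  qed
  also have "sum g {-int N + 1..int N} + g (- int N) = S"
  proof -
    have "{-int N..int N} = insert (- int N) {-int N + 1..int N}" by auto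
    then show ?thesis by (simp add: S_def)
  qed
  finally have "g 1 * S = S" .
  moreover have "g 1 \<noteq> 1"
  proof
    assume "g 1 = 1"
    then have "cos (of_int l * (2 * pi / M)) = 1"
      by (simp add: g_def complex_eq_iff)
    then obtain r :: int where "of_int l * (2 * pi / M) = of_int r * 2 * pi"
      using cos_one_2pi_int by auto
    then have "of_int l = of_int r * M" using M by (simp add: field_simps)
    then have "of_int l = (of_int (r * (2 * int N + 1)) :: real)" by (simp add: M_def)
    then have l: "l = r * (2 * int N + 1)" by (simp only: of_int_eq_iff)
    then have "r \<noteq> 0" using False by auto
    then have "1 * (2 * int N + 1) \<le> \<bar>r\<bar> * (2 * int N + 1)" by (intro mult_right_mono) auto
    also have "\<dots> = \<bar>l\<bar>" by (simp add: l abs_mult)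
    finally have "2 * int N < \<bar>l\<bar>" by simp
    with assms show False by simp
  qed
  ultimately have "S = 0" by (metis mult_cancel_right1)
  then show ?thesis using False by (simp add: S_def g_def M_def)
qed

text \<open>Induction on \<open>k\<close>: one factor \<open>cos x\<close> turns frequency
  \<open>l\<close> into the mean of the frequencies \<open>l + 1\<close> and \<open>l - 1\<close>.
  This spends one power and raises |l| by at most one, so the degree bound survives.\<close>

lemma quadrature_cos_power_cis:
  fixes N :: nat and l :: int
  assumes "\<bar>l\<bar> + int k \<le> 2 * int N"
  shows "integral {-pi..pi} (\<lambda>x. of_real (cos x ^ k) * cis (of_int l * x)) =
    of_real (2 * pi / (2 * real N + 1)) * (\<Sum>j\<in>{-int N..int N}.
      of_real (cos (2 * pi * of_int j / (2 * real N + 1)) ^ k) *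
      cis (of_int l * (2 * pi * of_int j / (2 * real N + 1))))"
  using assms
proof (induction k arbitrary: l)
  case 0
  have "of_real (2 * pi / (2 * real N + 1)) * of_nat (2 * N + 1) =
      (of_real (2 * pi / (2 * real N + 1) * (2 * real N + 1)) :: complex)"
    by (simp only: of_real_mult of_real_add of_real_of_nat_eq of_nat_add of_nat_mult) simp
  also have "2 * pi / (2 * real N + 1) * (2 * real N + 1) = 2 * pi" by simp
  finally show ?case using 0
    by (simp only: integral_cis_int sum_roots_of_unity_symmetric power_0 of_real_1 mult_1 split: if_split)
       simp
next
  case (Suc k)
  have split: "of_real (cos x ^ Suc k) * cis (of_int l * x) =
      (of_real (cos x ^ k) * cis (of_int (l + 1) * x) +
       of_real (cos x ^ k) * cis (of_int (l - 1) * x)) / 2" for x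
  proof -
    have "cis (of_int (l + 1) * x) = cis (of_int l * x) * cis x"
      "cis (of_int (l - 1) * x) = cis (of_int l * x) * cis (-x)"
      by (simp_all add: cis_mult algebra_simps)
    moreover have "cis x + cis (-x) = of_real (2 * cos x)" by (simp add: complex_eq_iff)
    ultimately have "of_real (cos x ^ k) * cis (of_int (l + 1) * x) +
       of_real (cos x ^ k) * cis (of_int (l - 1) * x) =
       of_real (cos x ^ k) * cis (of_int l * x) * of_real (2 * cos x)"
      by (metis distrib_left mult.assoc)
    then show ?thesis by simp
  qed
  have int: "(\<lambda>x. of_real (cos x ^ k) * cis (of_int l' * x)) integrable_on {-pi..pi}" for l'
    by (intro integrable_continuous_real continuous_intros)
  show ?case
  proof -
    have "integral {-pi..pi} (\<lambda>x. of_real (cos x ^ Suc k) * cis (of_int l * x)) =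
      (integral {-pi..pi} (\<lambda>x. of_real (cos x ^ k) * cis (of_int (l + 1) * x)) +
       integral {-pi..pi} (\<lambda>x. of_real (cos x ^ k) * cis (of_int (l - 1) * x))) / 2"
      unfolding split integral_divide by (simp only: integral_add[OF int int])
    also have "\<bar>l + 1\<bar> + int k \<le> 2 * int N" "\<bar>l - 1\<bar> + int k \<le> 2 * int N"
      using Suc.prems by auto
    note IH = this[THEN Suc.IH]
    note IH(1)
    also note IH(2)
    finally show ?thesis
      unfolding split sum_divide_distrib[symmetric] sum.distrib
      by (simp only: distrib_left[symmetric] times_divide_eq_right)
  qed
qed

section \<open>Trigonometric polynomials and the Toeplitz quadratic form\<close>

definition trig_sum :: "nat \<Rightarrow> (nat \<Rightarrow> complex) \<Rightarrow> real \<Rightarrow> complex" where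
  "trig_sum n v x = (\<Sum>t<n. v t * cis (real t * x))"

lemma continuous_on_trig_sum [continuous_intros]: "continuous_on S (trig_sum n v)"
  unfolding trig_sum_def by (intro continuous_intros)

lemma norm_trig_sum_square:
  "of_real ((norm (trig_sum n v x))\<^sup>2) =
    (\<Sum>s<n. \<Sum>t<n. cnj (v s) * v t * cis (of_int (int t - int s) * x))"
proof -
  have "of_real ((norm (trig_sum n v x))\<^sup>2) = cnj (trig_sum n v x) * trig_sum n v x"
    by (simp add: complex_norm_square mult.commute del: of_real_power)
  also have "\<dots> = (\<Sum>s<n. \<Sum>t<n. cnj (v s) * v t * (cis (- (real s * x)) * cis (real t * x)))"
    unfolding trig_sum_def cnj_sum sum_product complex_cnj_mult
    by (intro sum.cong refl) (simp add: cis_cnj mult_ac)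
  also have "\<dots> = (\<Sum>s<n. \<Sum>t<n. cnj (v s) * v t * cis (of_int (int t - int s) * x))"
    unfolding cis_mult by (simp add: algebra_simps)
  finally show ?thesis .
qed

lemma integral_complex_of_real:
  assumes "g integrable_on S"
  shows "integral S (\<lambda>x. complex_of_real (g x)) = of_real (integral S g)"
  using integral_linear[OF assms bounded_linear_of_real[where 'a = complex]] by (simp add: o_def)

lemma fourier_coeff_eq_integral:
  assumes "continuous_on {-pi..pi} f"
  shows "fourier_coeff (\<lambda>x. of_real (f x)) k =
    integral {-pi..pi} (\<lambda>x. of_real (f x) * cis (of_int (- k) * x)) / of_real (2 * pi)"
proof -
  have "(\<lambda>x. complex_of_real (f x) * cis (of_int (- k) * x)) absolutely_integrable_on {-pi..pi}"
    by (intro absolutely_integrable_continuous_real continuous_intros assms)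
  from set_lebesgue_integral_eq_integral(2)[OF this] show ?thesis
    by (simp add: fourier_coeff_def cis_conv_exp mult_ac)
qed

lemma integral_norm_trig_sum_square:
  assumes "continuous_on {-pi..pi} f"
  shows "of_real (integral {-pi..pi} (\<lambda>x. f x * (norm (trig_sum n v x))\<^sup>2)) =
    (\<Sum>s<n. \<Sum>t<n. cnj (v s) * v t *
      integral {-pi..pi} (\<lambda>x. of_real (f x) * cis (of_int (int t - int s) * x)))"
proof -
  have "of_real (integral {-pi..pi} (\<lambda>x. f x * (norm (trig_sum n v x))\<^sup>2)) =
      integral {-pi..pi} (\<lambda>x. complex_of_real (f x * (norm (trig_sum n v x))\<^sup>2))"
    by (intro integral_complex_of_real[symmetric] integrable_continuous_real continuous_intros assms)
  also have "(\<lambda>x. complex_of_real (f x * (norm (trig_sum n v x))\<^sup>2)) =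
      (\<lambda>x. \<Sum>s<n. \<Sum>t<n. cnj (v s) * v t * (of_real (f x) * cis (of_int (int t - int s) * x)))"
    unfolding of_real_mult norm_trig_sum_square by (simp add: sum_distrib_left mult_ac)
  also have "integral {-pi..pi} \<dots> = (\<Sum>s<n. \<Sum>t<n. integral {-pi..pi}
      (\<lambda>x. cnj (v s) * v t * (of_real (f x) * cis (of_int (int t - int s) * x))))"
    by (subst integral_sum, simp, intro integrable_continuous_real continuous_intros assms,
        intro sum.cong refl integral_sum integrable_continuous_real continuous_intros assms) simp
  finally show ?thesis by simp
qed

text \<open>The coefficient of index \<open>s - t\<close> integrates against frequency
  \<open>t - s\<close>, which is the frequency of \<open>cnj (v s) * v t\<close> in the expansion of
  |V|^2.\<close>

lemma toeplitz_form:
  assumes "continuous_on {-pi..pi} f"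
  shows "(\<Sum>s<n. \<Sum>t<n. cnj (v s) * fourier_coeff (\<lambda>x. of_real (f x)) (int s - int t) * v t) =
    of_real (integral {-pi..pi} (\<lambda>x. f x * (norm (trig_sum n v x))\<^sup>2) / (2 * pi))"
  unfolding of_real_divide integral_norm_trig_sum_square[OF assms] sum_divide_distrib
    fourier_coeff_eq_integral[OF assms]
  by (intro sum.cong refl) (simp add: field_simps)

lemma parseval_trig_sum:
  "integral {-pi..pi} (\<lambda>x. (norm (trig_sum n v x))\<^sup>2) = 2 * pi * (\<Sum>t<n. (norm (v t))\<^sup>2)"
proof -
  have eq: "int t - int s = 0 \<longleftrightarrow> t = s" for s t by auto
  have "complex_of_real (integral {-pi..pi} (\<lambda>x. 1 * (norm (trig_sum n v x))\<^sup>2)) =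
      (\<Sum>s<n. cnj (v s) * v s * of_real (2 * pi))"
    by (subst integral_norm_trig_sum_square)
       (simp_all add: integral_cis_int eq if_distrib[of "\<lambda>z. _ * z"] cong: if_cong
        del: of_int_diff)
  also have "\<dots> = of_real (2 * pi * (\<Sum>t<n. (norm (v t))\<^sup>2))"
    unfolding of_real_mult of_real_sum complex_norm_square sum_distrib_left
    by (simp add: mult_ac)
  finally show ?thesis by (simp only: of_real_eq_iff mult_1)
qed

text \<open>The indices from \<open>- N\<close> to \<open>N\<close> give equally spaced points
  closed under negation, so those with index in \<open>{0..N}\<close> represent all pairs of
  opposite nodes.\<close>

definition node :: "nat \<Rightarrow> int \<Rightarrow> real" where
  "node N j = 2 * pi * of_int j / (2 * real N + 1)"

text \<open>Each term of q |V|^2 is a power \<open>cos x ^ i\<close> with \<open>i \<le> m\<close>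
  times a frequency \<open>t - s\<close> with |t - s| < n; hence |t - s| + i is at most
  \<open>2 * N\<close>, and the rule is exact term by term.\<close>

lemma quadrature_trig_sum:
  fixes a :: "nat \<Rightarrow> real"
  assumes "n + m \<le> 2 * N + 1"
  shows "integral {-pi..pi} (\<lambda>x. (\<Sum>i\<le>m. a i * cos x ^ i) * (norm (trig_sum n v x))\<^sup>2) =
    2 * pi / (2 * real N + 1) * (\<Sum>j\<in>{-int N..int N}.
      (\<Sum>i\<le>m. a i * cos (node N j) ^ i) * (norm (trig_sum n v (node N j)))\<^sup>2)"
    (is "integral _ (\<lambda>x. ?q x * _) = ?rhs")
proof -
  let ?w = "2 * pi / (2 * real N + 1)"
  have quad: "integral {-pi..pi} (\<lambda>x. of_real (?q x) * cis (of_int (int t - int s) * x)) =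
      of_real ?w * (\<Sum>j\<in>{-int N..int N}.
        of_real (?q (node N j)) * cis (of_int (int t - int s) * node N j))"
    if "s < n" "t < n" for s t
  proof -
    have "integral {-pi..pi} (\<lambda>x. of_real (?q x) * cis (of_int (int t - int s) * x)) =
      (\<Sum>i\<le>m. integral {-pi..pi} (\<lambda>x. of_real (a i) * (of_real (cos x ^ i) * cis (of_int (int t - int s) * x))))"
      unfolding of_real_sum of_real_mult sum_distrib_right mult.assoc
      by (intro integral_sum integrable_continuous_real continuous_intros) simp
    also have "\<dots> = (\<Sum>i\<le>m. of_real (a i) * (of_real ?w * (\<Sum>j\<in>{-int N..int N}.
        of_real (cos (node N j) ^ i) * cis (of_int (int t - int s) * node N j))))"
      unfolding integral_mult_right node_def
      by (intro sum.cong refl arg_cong2[of _ _ _ _ "(*)"] quadrature_cos_power_cis)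
         (use that assms in auto)
    also have "\<dots> = of_real ?w * (\<Sum>i\<le>m. \<Sum>j\<in>{-int N..int N}.
        of_real (a i * cos (node N j) ^ i) * cis (of_int (int t - int s) * node N j))"
      unfolding sum_distrib_left by (intro sum.cong refl) (simp add: mult_ac)
    also have "\<dots> = of_real ?w * (\<Sum>j\<in>{-int N..int N}.
        of_real (?q (node N j)) * cis (of_int (int t - int s) * node N j))"
      by (subst sum.swap) (simp add: sum_distrib_right)
    finally show ?thesis .
  qed
  have "complex_of_real (integral {-pi..pi} (\<lambda>x. ?q x * (norm (trig_sum n v x))\<^sup>2)) =
    (\<Sum>s<n. \<Sum>t<n. cnj (v s) * v t * (of_real ?w * (\<Sum>j\<in>{-int N..int N}.
        of_real (?q (node N j)) * cis (of_int (int t - int s) * node N j))))"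
    by (subst integral_norm_trig_sum_square, intro continuous_intros)
       (intro sum.cong refl arg_cong2[of _ _ _ _ "(*)"] quad; simp)
  also have "\<dots> = (\<Sum>s<n. \<Sum>t<n. \<Sum>j\<in>{-int N..int N}. of_real ?w * of_real (?q (node N j)) *
      (cnj (v s) * v t * cis (of_int (int t - int s) * node N j)))"
    unfolding sum_distrib_left by (intro sum.cong refl) (simp only: mult_ac)
  also have "\<dots> = (\<Sum>j\<in>{-int N..int N}. \<Sum>s<n. \<Sum>t<n. of_real ?w * of_real (?q (node N j)) *
      (cnj (v s) * v t * cis (of_int (int t - int s) * node N j)))"
    by (subst sum.swap[of _ "{-int N..int N}"], subst sum.swap[of _ "{-int N..int N}"]) simp
  also have "\<dots> = (\<Sum>j\<in>{-int N..int N}. of_real ?w * of_real (?q (node N j)) *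
      of_real ((norm (trig_sum n v (node N j)))\<^sup>2))"
    by (simp only: norm_trig_sum_square sum_distrib_left)
  also have "\<dots> = of_real ?rhs"
    unfolding of_real_mult of_real_sum[of _ "{-int N..int N}"] sum_distrib_left[of _ _ "{-int N..int N}"]
    by (simp only: mult.assoc)
  finally show ?thesis by (simp only: of_real_eq_iff)
qed

lemma node_bounds:
  assumes "j \<in> {-int N..int N}"
  shows "node N j \<in> {-pi..pi}"
proof -
  have "\<bar>2 * of_int j\<bar> \<le> 2 * real N + 1"
    using assms by auto
  then have "\<bar>2 * of_int j / (2 * real N + 1)\<bar> \<le> 1" by simp
  then have "\<bar>pi * (2 * of_int j / (2 * real N + 1))\<bar> \<le> pi * 1"
    unfolding abs_mult by (intro mult_mono) auto
  moreover have "node N j = pi * (2 * of_int j / (2 * real N + 1))"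
    by (simp add: node_def)
  ultimately show ?thesis by (simp only: abs_le_iff) auto
qed

text \<open>Quadrature expresses the integral of q |V|^2 by node values, and at a node either V
  vanishes or q is at least \<open>b - \<epsilon>\<close>. Passing from f to q at the nodes and from
  q back to f under the integral costs \<epsilon> each time, hence
  \<open>b - 2 * \<epsilon>\<close>.\<close>

lemma toeplitz_form_lower_bound:
  fixes a :: "nat \<Rightarrow> real"
  assumes f: "continuous_on {-pi..pi} f"
    and approx: "\<And>x. x \<in> {-pi..pi} \<Longrightarrow> \<bar>f x - (\<Sum>i\<le>m. a i * cos x ^ i)\<bar> \<le> \<epsilon>"
    and N: "n + m \<le> 2 * N + 1"
    and nodes: "\<And>j. j \<in> {-int N..int N} \<Longrightarrow> trig_sum n v (node N j) = 0 \<or> b \<le> f (node N j)"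
  shows "2 * pi * ((b - 2 * \<epsilon>) * (\<Sum>t<n. (norm (v t))\<^sup>2)) \<le>
    integral {-pi..pi} (\<lambda>x. f x * (norm (trig_sum n v x))\<^sup>2)"
proof -
  let ?q = "\<lambda>x. \<Sum>i\<le>m. a i * cos x ^ i"
  let ?V = "\<lambda>x. (norm (trig_sum n v x))\<^sup>2"
  have I: "(\<lambda>x. ?q x * ?V x) integrable_on {-pi..pi}" "?V integrable_on {-pi..pi}"
    "(\<lambda>x. \<epsilon> * ?V x) integrable_on {-pi..pi}"
    "(\<lambda>x. f x * ?V x) integrable_on {-pi..pi}"
    by (intro integrable_continuous_real continuous_intros f)+
  \<comment> \<open>The constant 1 is written as a polynomial of degree 0 in cos, so that the same
    rule also computes the squared norm.\<close>
  have "(b - \<epsilon>) * (2 * pi * (\<Sum>t<n. (norm (v t))\<^sup>2)) =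
      (b - \<epsilon>) * integral {-pi..pi} (\<lambda>x. (\<Sum>i\<le>0. 1 * cos x ^ i) * ?V x)"
    by (simp add: parseval_trig_sum)
  also have "\<dots> = 2 * pi / (2 * real N + 1) * (\<Sum>j\<in>{-int N..int N}. (b - \<epsilon>) * ?V (node N j))"
    using N by (subst quadrature_trig_sum[of _ _ N]) (simp_all add: sum_distrib_left mult_ac)
  also have "\<dots> \<le> 2 * pi / (2 * real N + 1) * (\<Sum>j\<in>{-int N..int N}. ?q (node N j) * ?V (node N j))"
  proof (intro mult_left_mono sum_mono)
    fix j assume j: "j \<in> {-int N..int N}"
    show "(b - \<epsilon>) * ?V (node N j) \<le> ?q (node N j) * ?V (node N j)"
    proof (cases "trig_sum n v (node N j) = 0")
      case False
      then have "b - \<epsilon> \<le> ?q (node N j)"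
        using nodes[OF j] approx[OF node_bounds[OF j]] by linarith
      then show ?thesis by (intro mult_right_mono) auto
    qed simp
  qed simp
  also have "\<dots> = integral {-pi..pi} (\<lambda>x. ?q x * ?V x)"
    by (rule quadrature_trig_sum[OF N, symmetric])
  also have "\<dots> \<le> integral {-pi..pi} (\<lambda>x. f x * ?V x + \<epsilon> * ?V x)"
  proof (intro integral_le I integrable_add)
    fix x assume "x \<in> {-pi..pi}"
    from approx[OF this] have "?q x \<le> f x + \<epsilon>" by linarith
    then show "?q x * ?V x \<le> f x * ?V x + \<epsilon> * ?V x"
      unfolding distrib_right[symmetric] by (intro mult_right_mono) auto
  qed
  also have "\<dots> = integral {-pi..pi} (\<lambda>x. f x * ?V x) + \<epsilon> * (2 * pi * (\<Sum>t<n. (norm (v t))\<^sup>2))"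
    by (subst integral_add[OF I(4) I(3)]) (simp add: parseval_trig_sum)
  finally show ?thesis by (simp add: algebra_simps)
qed

section \<open>Counting eigenvalues by nodes\<close>

text \<open>Gaussian elimination, one equation per induction step. This dimension count is used for
  vanishing at nodes, for orthogonal complements and for Krylov vectors.\<close>

lemma nontrivial_solution:
  fixes F :: "'a \<Rightarrow> 'b \<Rightarrow> 'c :: field"
  assumes "finite K" "finite J" "card K < card J"
  shows "\<exists>c. (\<exists>j\<in>J. c j \<noteq> 0) \<and> (\<forall>k\<in>K. (\<Sum>j\<in>J. c j * F k j) = 0)"
  using assms
proof (induction K arbitrary: J F rule: finite_induct)
  case empty
  then have "J \<noteq> {}" by auto
  then show ?case by (intro exI[of _ "\<lambda>_. 1"]) auto
next
  case (insert k K)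
  show ?case
  proof (cases "\<forall>j\<in>J. F k j = 0")
    case True
    moreover obtain c where "\<exists>j\<in>J. c j \<noteq> 0" "\<forall>k\<in>K. (\<Sum>j\<in>J. c j * F k j) = 0"
      using insert.IH[of J F] insert.prems insert.hyps by auto
    ultimately show ?thesis by (intro exI[of _ c]) auto
  next
    case False
    then obtain j0 where j0: "j0 \<in> J" "F k j0 \<noteq> 0" by blast
    \<comment> \<open>\<open>G\<close> is the system after equation \<open>k\<close> has been used
      to eliminate the unknown \<open>j0\<close>; \<open>c'\<close> is the back
      substitution.\<close>
    define G where "G k' j = F k' j - F k' j0 * F k j / F k j0" for k' j
    obtain c where c: "\<exists>j\<in>J - {j0}. c j \<noteq> 0" "\<forall>k\<in>K. (\<Sum>j\<in>J - {j0}. c j * G k j) = 0"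
      using insert.IH[of "J - {j0}" G] insert.prems insert.hyps j0
      by (auto simp: card_Diff_singleton less_diff_conv)
    define c' where "c' = c(j0 := - (\<Sum>j\<in>J - {j0}. c j * F k j) / F k j0)"
    have sum: "(\<Sum>j\<in>J. c' j * F k' j) = (\<Sum>j\<in>J - {j0}. c j * G k' j)" for k'
    proof -
      have "(\<Sum>j\<in>J. c' j * F k' j) = c' j0 * F k' j0 + (\<Sum>j\<in>J - {j0}. c j * F k' j)"
        using insert.prems j0 by (subst sum.remove[of _ j0]) (auto simp: c'_def intro!: sum.cong)
      also have "c' j0 * F k' j0 = - (\<Sum>j\<in>J - {j0}. c j * (F k' j0 * F k j / F k j0))"
        by (simp add: c'_def sum_distrib_left sum_distrib_right sum_divide_distrib mult_ac)
      finally show ?thesis by (simp add: G_def sum_subtractf right_diff_distrib)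
    qed
    have "G k j = 0" for j using j0 by (simp add: G_def)
    with c sum show ?thesis by (intro exI[of _ c']) (auto simp: c'_def)
  qed
qed

definition orthonormal_on :: "nat \<Rightarrow> 'a set \<Rightarrow> ('a \<Rightarrow> nat \<Rightarrow> complex) \<Rightarrow> bool" where
  "orthonormal_on n J u \<longleftrightarrow>
     (\<forall>j\<in>J. \<forall>k\<in>J. (\<Sum>i<n. cnj (u j i) * u k i) = (if j = k then 1 else 0))"

lemma orthonormal_on_subset: "orthonormal_on n J u \<Longrightarrow> I \<subseteq> J \<Longrightarrow> orthonormal_on n I u"
  unfolding orthonormal_on_def by blast

lemma orthonormal_on_inner:
  assumes "orthonormal_on n J u" "finite J"
  shows "(\<Sum>i<n. cnj (\<Sum>j\<in>J. c j * u j i) * (\<Sum>j\<in>J. d j * u j i)) = (\<Sum>j\<in>J. cnj (c j) * d j)"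
proof -
  have "(\<Sum>i<n. cnj (\<Sum>j\<in>J. c j * u j i) * (\<Sum>j\<in>J. d j * u j i)) =
      (\<Sum>i<n. \<Sum>j\<in>J. \<Sum>k\<in>J. cnj (c j) * d k * (cnj (u j i) * u k i))"
    unfolding cnj_sum sum_product complex_cnj_mult by (simp only: mult_ac)
  also have "\<dots> = (\<Sum>j\<in>J. \<Sum>k\<in>J. \<Sum>i<n. cnj (c j) * d k * (cnj (u j i) * u k i))"
    by (subst sum.swap) (intro sum.cong refl sum.swap)
  also have "\<dots> = (\<Sum>j\<in>J. \<Sum>k\<in>J. if j = k then cnj (c j) * d k else 0)"
    using assms(1) unfolding sum_distrib_left[symmetric] orthonormal_on_def
    by (intro sum.cong refl) auto
  also have "\<dots> = (\<Sum>j\<in>J. cnj (c j) * d j)"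
    using assms(2) by (simp)
  finally show ?thesis .
qed

text \<open>Reversing the order of summation absorbs the reflection of \<open>x\<close> into a
  phase. Consequently a zero of V at a node is also a zero at the opposite node.\<close>

lemma trig_sum_reflect:
  assumes "\<And>i. i < n \<Longrightarrow> v (n - 1 - i) = s * v i"
  shows "trig_sum n v (- x) = s * cis (- (real (n - 1) * x)) * trig_sum n v x"
proof -
  have "trig_sum n v (- x) = (\<Sum>t<n. v (n - 1 - t) * cis (real (n - 1 - t) * (- x)))"
    unfolding trig_sum_def
    by (rule sum.reindex_bij_witness[of _ "\<lambda>t. n - 1 - t" "\<lambda>t. n - 1 - t"]) auto
  also have "\<dots> = (\<Sum>t<n. s * cis (- (real (n - 1) * x)) * (v t * cis (real t * x)))"
  proof (intro sum.cong refl)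
    fix t assume t: "t \<in> {..<n}"
    have "real (n - 1 - t) = real (n - 1) - real t" using t by (intro of_nat_diff) auto
    then have "cis (real (n - 1 - t) * (- x)) = cis (- (real (n - 1) * x)) * cis (real t * x)"
      unfolding cis_mult by (simp only: left_diff_distrib) simp
    then show "v (n - 1 - t) * cis (real (n - 1 - t) * (- x)) =
        s * cis (- (real (n - 1) * x)) * (v t * cis (real t * x))"
      using assms t by simp
  qed
  finally show ?thesis by (simp add: trig_sum_def sum_distrib_left)
qed

text \<open>With more eigenvectors than elements of \<open>K\<close>, a nonzero combination v would
  make V vanish at the nodes of \<open>K\<close> and, by symmetry, at their opposites. The form at v
  would then be at least \<open>b - 2 * \<epsilon>\<close> times the squared norm, but all
  eigenvalues involved are smaller. A general even symbol is allowed so that \<open>- f\<close> can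
  be inserted to count large eigenvalues.\<close>

lemma card_eigenvalues_le_card_nodes:
  fixes a e :: "nat \<Rightarrow> real" and f :: "real \<Rightarrow> real"
  defines "c \<equiv> fourier_coeff (\<lambda>x. of_real (f x))"
  assumes f: "continuous_on {-pi..pi} f" "\<And>x. x \<in> {-pi..pi} \<Longrightarrow> f (- x) = f x"
    and approx: "\<And>x. x \<in> {-pi..pi} \<Longrightarrow> \<bar>f x - (\<Sum>i\<le>m. a i * cos x ^ i)\<bar> \<le> \<epsilon>"
    and N: "n + m \<le> 2 * N + 1"
    and u: "orthonormal_on n J u" "finite J"
    and sym: "\<And>j i. j \<in> J \<Longrightarrow> i < n \<Longrightarrow> u j (n - 1 - i) = s * u j i"
    and eig: "\<And>j i. j \<in> J \<Longrightarrow> i < n \<Longrightarrow> (\<Sum>t<n. c (int i - int t) * u j t) = of_real (e j) * u j i"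
    and less: "\<And>j. j \<in> J \<Longrightarrow> e j < b - 2 * \<epsilon>"
    and K: "K \<subseteq> {..N}" "\<And>k. k \<le> N \<Longrightarrow> k \<notin> K \<Longrightarrow> b \<le> f (node N (int k))"
  shows "card J \<le> card K"
proof (rule ccontr)
  assume "\<not> ?thesis"
  moreover have "finite K" using K(1) finite_subset by blast
  ultimately obtain w where w: "\<exists>j\<in>J. w j \<noteq> 0"
    "\<forall>k\<in>K. (\<Sum>j\<in>J. w j * trig_sum n (u j) (node N (int k))) = 0"
    using nontrivial_solution[of K J "\<lambda>k j. trig_sum n (u j) (node N (int k))"] u(2) by auto
  define v where "v i = (\<Sum>j\<in>J. w j * u j i)" for i
  have trig: "trig_sum n v x = (\<Sum>j\<in>J. w j * trig_sum n (u j) x)" for x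
    unfolding trig_sum_def v_def sum_distrib_left sum_distrib_right
    by (subst sum.swap) (simp add: mult_ac)
  have v_sym: "v (n - 1 - i) = s * v i" if "i < n" for i
    using sym that by (simp add: v_def sum_distrib_left mult_ac)
  have nodes: "trig_sum n v (node N j) = 0 \<or> b \<le> f (node N j)" if j: "j \<in> {-int N..int N}" for j
  proof -
    define k where "k = nat \<bar>j\<bar>"
    have k: "k \<le> N" "j = int k \<or> j = - int k" using j by (auto simp: k_def)
    have neg: "node N (- int k) = - node N (int k)" by (simp add: node_def)
    have "node N (int k) \<in> {-pi..pi}" using k by (intro node_bounds) auto
    note even = f(2)[OF this]
    show ?thesis
    proof (cases "k \<in> K")
      case True
      then have "trig_sum n v (node N (int k)) = 0" using w trig by simp
      then show ?thesis using k(2) trig_sum_reflect[of n v s, OF v_sym] neg by auto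
    next
      case False
      with K(2) k(1) have "b \<le> f (node N (int k))" by blast
      then show ?thesis using k(2) neg even by auto
    qed
  qed
  have norm_v: "(\<Sum>t<n. (norm (v t))\<^sup>2) = (\<Sum>j\<in>J. (norm (w j))\<^sup>2)"
  proof -
    have "complex_of_real (\<Sum>t<n. (norm (v t))\<^sup>2) = of_real (\<Sum>j\<in>J. (norm (w j))\<^sup>2)"
      unfolding of_real_sum complex_norm_square mult.commute[of _ "cnj _"] v_def
      by (rule orthonormal_on_inner[OF u])
    then show ?thesis by (simp only: of_real_eq_iff)
  qed
  have form: "integral {-pi..pi} (\<lambda>x. f x * (norm (trig_sum n v x))\<^sup>2) / (2 * pi) =
      (\<Sum>j\<in>J. e j * (norm (w j))\<^sup>2)"
  proof -
    have "of_real (integral {-pi..pi} (\<lambda>x. f x * (norm (trig_sum n v x))\<^sup>2) / (2 * pi)) =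
        (\<Sum>s<n. cnj (v s) * (\<Sum>t<n. c (int s - int t) * v t))"
      unfolding toeplitz_form[OF f(1), symmetric] c_def by (simp add: sum_distrib_left mult.assoc)
    also have "\<dots> = (\<Sum>s<n. cnj (v s) * (\<Sum>j\<in>J. (of_real (e j) * w j) * u j s))"
    proof (rule sum.cong[OF refl])
      fix s assume s: "s \<in> {..<n}"
      have "(\<Sum>t<n. c (int s - int t) * v t) = (\<Sum>j\<in>J. w j * (\<Sum>t<n. c (int s - int t) * u j t))"
        unfolding v_def sum_distrib_left by (subst sum.swap) (simp add: mult_ac)
      also have "\<dots> = (\<Sum>j\<in>J. (of_real (e j) * w j) * u j s)"
        using s eig by (intro sum.cong) auto
      finally show "cnj (v s) * (\<Sum>t<n. c (int s - int t) * v t) =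
          cnj (v s) * (\<Sum>j\<in>J. (of_real (e j) * w j) * u j s)" by (rule arg_cong)
    qed
    also have "\<dots> = (\<Sum>j\<in>J. cnj (w j) * (of_real (e j) * w j))"
      unfolding v_def by (rule orthonormal_on_inner[OF u])
    also have "\<dots> = of_real (\<Sum>j\<in>J. e j * (norm (w j))\<^sup>2)"
      unfolding of_real_sum of_real_mult complex_norm_square by (simp add: mult_ac)
    finally show ?thesis by (simp only: of_real_eq_iff)
  qed
  have "(b - 2 * \<epsilon>) * (\<Sum>j\<in>J. (norm (w j))\<^sup>2) \<le> (\<Sum>j\<in>J. e j * (norm (w j))\<^sup>2)"
  proof -
    have "(b - 2 * \<epsilon>) * (\<Sum>t<n. (norm (v t))\<^sup>2) \<le>
        integral {-pi..pi} (\<lambda>x. f x * (norm (trig_sum n v x))\<^sup>2) / (2 * pi)"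
      using toeplitz_form_lower_bound[OF f(1) approx N nodes] by (simp add: le_divide_eq mult.commute)
    then show ?thesis by (simp only: norm_v form)
  qed
  also have "\<dots> < (\<Sum>j\<in>J. (b - 2 * \<epsilon>) * (norm (w j))\<^sup>2)"
  proof -
    obtain j0 where "j0 \<in> J" "w j0 \<noteq> 0" using w(1) by blast
    with less have "\<exists>j\<in>J. e j * (norm (w j))\<^sup>2 < (b - 2 * \<epsilon>) * (norm (w j))\<^sup>2"
      by (intro bexI[of _ j0] mult_strict_right_mono) auto
    moreover have "\<forall>j\<in>J. e j * (norm (w j))\<^sup>2 \<le> (b - 2 * \<epsilon>) * (norm (w j))\<^sup>2"
      using less by (intro ballI mult_right_mono) (auto intro: less_imp_le)
    ultimately show ?thesis using u(2) by (intro sum_strict_mono_ex1)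
  qed
  finally show False by (simp add: sum_distrib_left)
qed

section \<open>Hermitian matrices\<close>

text \<open>Krylov argument: some nonzero polynomial in the operator annihilates the given vector of the
  invariant subspace; splitting off its roots one at a time yields an eigenvector.\<close>

lemma eigenvector_in_invariant_subspace:
  fixes A :: "nat \<Rightarrow> nat \<Rightarrow> complex" and W :: "(nat \<Rightarrow> complex) set"
  assumes W_op: "\<And>w. w \<in> W \<Longrightarrow> (\<lambda>i. \<Sum>k<n. A i k * w k) \<in> W"
    and W_lin: "\<And>v w a b. v \<in> W \<Longrightarrow> w \<in> W \<Longrightarrow> (\<lambda>i. a * v i + b * w i) \<in> W"
    and w: "w \<in> W" "\<exists>i<n. w i \<noteq> 0"
  shows "\<exists>v\<in>W. \<exists>a. (\<exists>i<n. v i \<noteq> 0) \<and> (\<forall>i<n. (\<Sum>k<n. A i k * v k) = a * v i)"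
proof -
  define L where "L v = (\<lambda>i. \<Sum>k<n. A i k * v k)" for v
  \<comment> \<open>\<open>act p v\<close> is the polynomial \<open>p\<close> in the operator
    \<open>L\<close>, applied to \<open>v\<close>.\<close>
  define act where "act p v = (\<lambda>i. \<Sum>k\<le>degree p. coeff p k * (L ^^ k) v i)" for p v
  have L_W: "(L ^^ k) v \<in> W" if "v \<in> W" for k v
    using that by (induction k) (auto simp: L_def W_op)
  \<comment> \<open>The degree may be overestimated, so that \<open>q\<close> and its product with a
    linear factor can be expanded over the same range.\<close>
  have act_eq: "act p v i = (\<Sum>k\<le>d. coeff p k * (L ^^ k) v i)" if "degree p \<le> d" for p v i d
    unfolding act_def using that by (intro sum.mono_neutral_left) (auto simp: coeff_eq_0)
  have zero_W: "(\<lambda>i. 0) \<in> W" using W_lin[OF w(1) w(1), of 0 0] by simp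
  have act_W: "act p v \<in> W" if v: "v \<in> W" for p v
  proof -
    have "(\<lambda>i. \<Sum>k<d. coeff p k * (L ^^ k) v i) \<in> W" for d
    proof (induction d)
      case (Suc d)
      from W_lin[OF this L_W[OF v], of 1 "coeff p d" d] show ?case by simp
    qed (simp add: zero_W)
    then show ?thesis unfolding act_def lessThan_Suc_atMost[symmetric] .
  qed
  have act_linear_factor: "act ([:-a, 1:] * q) v i = L (act q v) i - a * act q v i" for a q v i
  proof -
    define d where "d = degree q"
    have "degree ([:-a, 1:] * q) \<le> Suc d"
      using degree_mult_le[of "[:-a, 1:]" q] by (simp add: d_def)
    then have "act ([:-a, 1:] * q) v i = (\<Sum>k\<le>Suc d. coeff ([:-a, 1:] * q) k * (L ^^ k) v i)"
      by (rule act_eq)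
    also have "\<dots> = (\<Sum>k\<le>Suc d. coeff (pCons 0 q) k * (L ^^ k) v i) -
        a * (\<Sum>k\<le>Suc d. coeff q k * (L ^^ k) v i)"
      by (simp add: sum_subtractf[symmetric] sum_distrib_left algebra_simps del: sum.atMost_Suc)
    also have "(\<Sum>k\<le>Suc d. coeff q k * (L ^^ k) v i) = act q v i"
      by (rule act_eq[symmetric]) (simp add: d_def)
    also have "(\<Sum>k\<le>Suc d. coeff (pCons 0 q) k * (L ^^ k) v i) =
        (\<Sum>k\<le>d. coeff q k * L ((L ^^ k) v) i)"
      by (subst sum.atMost_Suc_shift) simp
    also have "\<dots> = L (act q v) i"
      unfolding act_eq[OF order_refl, of q, folded d_def] L_def sum_distrib_left
      by (subst sum.swap) (simp add: mult_ac)
    finally show ?thesis .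
  qed
  have main: "\<exists>v\<in>W. \<exists>a. (\<exists>i<n. v i \<noteq> 0) \<and> (\<forall>i<n. L v i = a * v i)"
    if "p \<noteq> 0" "\<forall>i<n. act p w i = 0" for p
    using that
  proof (induction "degree p" arbitrary: p)
    case 0
    then obtain c where c: "p = [:c:]" by (metis degree_eq_zeroE)
    then show ?case using 0 w(2) by (auto simp: act_def)
  next
    case (Suc d)
    then have "\<not> constant (poly p)" by (simp add: constant_degree)
    then obtain a where "poly p a = 0" using fundamental_theorem_of_algebra by blast
    then obtain q where q: "p = [:-a, 1:] * q" by (metis poly_eq_0_iff_dvd dvdE)
    then have "q \<noteq> 0" using Suc.prems by auto
    then have deg: "degree p = Suc (degree q)" unfolding q by (subst degree_mult_eq) auto
    show ?case
    proof (cases "\<forall>i<n. act q w i = 0")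
      case True
      have "d = degree q" using Suc.hyps(2) deg by simp
      from Suc.hyps(1)[OF this \<open>q \<noteq> 0\<close> True] show ?thesis .
    next
      case False
      moreover have "\<forall>i<n. L (act q w) i = a * act q w i"
        using Suc.prems(2) unfolding q act_linear_factor by simp
      ultimately show ?thesis by (intro bexI[of _ "act q w"] exI[of _ a] conjI act_W w) auto
    qed
  qed
  \<comment> \<open>The \<open>n + 1\<close> iterates of \<open>L\<close> on \<open>w\<close> have
    only \<open>n\<close> relevant coordinates, hence are linearly dependent; a dependence is an
    annihilating polynomial.\<close>
  obtain c where c: "\<exists>j\<in>{..n}. c j \<noteq> 0" "\<forall>i\<in>{..<n}. (\<Sum>j\<in>{..n}. c j * (L ^^ j) w i) = 0"
    using nontrivial_solution[of "{..<n}" "{..n}" "\<lambda>i j. (L ^^ j) w i"] by auto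
  define p where "p = (\<Sum>j\<le>n. monom (c j) j)"
  have coeff: "coeff p j = (if j \<le> n then c j else 0)" for j
    by (simp add: p_def coeff_sum)
  then have "p \<noteq> 0" using c(1) by (metis atMost_iff coeff_0)
  moreover have "degree p \<le> n" using coeff by (intro degree_le) auto
  then have "\<forall>i<n. act p w i = 0" using c(2) by (simp add: act_eq[of p n] coeff)
  ultimately show ?thesis using main by (simp add: L_def)
qed

lemma hermitian_form_adjoint:
  assumes "\<And>i k. i < n \<Longrightarrow> k < n \<Longrightarrow> A k i = cnj (A i k)"
  shows "(\<Sum>i<n. cnj (\<Sum>k<n. A i k * v k) * w i) = (\<Sum>i<n. cnj (v i) * (\<Sum>k<n. A i k * w k))"
proof -
  have "(\<Sum>i<n. cnj (\<Sum>k<n. A i k * v k) * w i) = (\<Sum>i<n. \<Sum>k<n. cnj (v k) * (A k i * w i))"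
    unfolding cnj_sum sum_distrib_right by (intro sum.cong) (simp_all add: assms[symmetric])
  also have "\<dots> = (\<Sum>k<n. \<Sum>i<n. cnj (v k) * (A k i * w i))" by (rule sum.swap)
  finally show ?thesis by (simp add: sum_distrib_left)
qed

text \<open>Eigenvectors are added one at a time: fewer than \<open>n\<close> orthonormal ones leave
  a nonzero orthogonal complement, which a Hermitian matrix maps into itself, so it contains a
  further eigenvector.\<close>

lemma hermitian_orthonormal_eigenvectors:
  fixes A :: "nat \<Rightarrow> nat \<Rightarrow> complex"
  assumes A: "\<And>i k. i < n \<Longrightarrow> k < n \<Longrightarrow> A k i = cnj (A i k)"
  shows "m \<le> n \<Longrightarrow> \<exists>u d. orthonormal_on n {..<m} u \<and>
    (\<forall>j<m. \<forall>i<n. (\<Sum>k<n. A i k * u j k) = complex_of_real (d j) * u j i)"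
proof (induction m)
  case 0
  then show ?case by (auto simp: orthonormal_on_def)
next
  case (Suc m)
  then obtain u d where u: "orthonormal_on n {..<m} u"
    and eig: "\<And>j i. j < m \<Longrightarrow> i < n \<Longrightarrow> (\<Sum>k<n. A i k * u j k) = complex_of_real (d j) * u j i"
    by auto
  define W where "W = {w. \<forall>j<m. (\<Sum>i<n. cnj (u j i) * w i) = 0}"
  obtain w where w: "w \<in> W" "\<exists>i<n. w i \<noteq> 0"
    using nontrivial_solution[of "{..<m}" "{..<n}" "\<lambda>j i. cnj (u j i)"] Suc.prems
    by (auto simp: W_def mult.commute)
  have W_op: "(\<lambda>i. \<Sum>k<n. A i k * w k) \<in> W" if "w \<in> W" for w
  proof -
    have "(\<Sum>i<n. cnj (u j i) * (\<Sum>k<n. A i k * w k)) = 0" if "j < m" for j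
    proof -
      have "(\<Sum>i<n. cnj (u j i) * (\<Sum>k<n. A i k * w k)) =
          (\<Sum>i<n. cnj (complex_of_real (d j) * u j i) * w i)"
        using eig[OF that] by (subst hermitian_form_adjoint[OF A, symmetric]) auto
      also have "\<dots> = of_real (d j) * (\<Sum>i<n. cnj (u j i) * w i)"
        by (simp add: sum_distrib_left mult.assoc)
      finally show ?thesis using \<open>w \<in> W\<close> that by (simp add: W_def)
    qed
    then show ?thesis by (simp add: W_def)
  qed
  have W_lin: "(\<lambda>i. a * v i + b * w i) \<in> W" if "v \<in> W" "w \<in> W" for v w a b
  proof -
    have "(\<Sum>i<n. cnj (u j i) * (a * v i + b * w i)) =
        a * (\<Sum>i<n. cnj (u j i) * v i) + b * (\<Sum>i<n. cnj (u j i) * w i)" for j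
      by (simp add: sum_distrib_left sum.distrib algebra_simps)
    with that show ?thesis by (simp add: W_def)
  qed
  have "\<exists>v\<in>W. \<exists>a. (\<exists>i<n. v i \<noteq> 0) \<and> (\<forall>i<n. (\<Sum>k<n. A i k * v k) = a * v i)"
    by (rule eigenvector_in_invariant_subspace[OF W_op W_lin w])
  then obtain v a where v: "v \<in> W" "\<exists>i<n. v i \<noteq> 0"
    "\<And>i. i < n \<Longrightarrow> (\<Sum>k<n. A i k * v k) = a * v i"
    by blast
  define r where "r = (\<Sum>i<n. (norm (v i))\<^sup>2)"
  have "r > 0" using v(2) unfolding r_def by (auto intro!: sum_pos2)
  have rr: "(\<Sum>i<n. cnj (v i) * v i) = of_real r"
    unfolding r_def of_real_sum complex_norm_square by (simp add: mult.commute)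
  \<comment> \<open>The eigenvalue is real: moving the matrix from one argument of the inner product
    to the other replaces \<open>a\<close> by its conjugate.\<close>
  have "cnj a * of_real r = a * of_real r"
  proof -
    have "cnj a * of_real r = (\<Sum>i<n. cnj (\<Sum>k<n. A i k * v k) * v i)"
      by (simp add: v(3) rr[symmetric] sum_distrib_left mult.assoc)
    also have "\<dots> = (\<Sum>i<n. cnj (v i) * (\<Sum>k<n. A i k * v k))"
      by (rule hermitian_form_adjoint[OF A])
    also have "\<dots> = (\<Sum>i<n. a * (cnj (v i) * v i))"
      by (intro sum.cong) (auto simp: v(3))
    also have "\<dots> = a * of_real r" by (simp only: rr sum_distrib_left[symmetric])
    finally show ?thesis .
  qed
  with \<open>r > 0\<close> have "cnj a = a" by simp
  then have a: "a = of_real (Re a)" by (simp add: complex_eq_iff)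
  define v' where "v' i = v i / of_real (sqrt r)" for i
  have orth: "(\<Sum>i<n. cnj (u j i) * v' i) = 0" "(\<Sum>i<n. cnj (v' i) * u j i) = 0" if "j < m" for j
  proof -
    show *: "(\<Sum>i<n. cnj (u j i) * v' i) = 0"
      using v(1) that by (simp add: v'_def W_def sum_divide_distrib[symmetric])
    have "(\<Sum>i<n. cnj (v' i) * u j i) = cnj (\<Sum>i<n. cnj (u j i) * v' i)" by (simp add: mult.commute)
    with * show "(\<Sum>i<n. cnj (v' i) * u j i) = 0" by simp
  qed
  have norm: "(\<Sum>i<n. cnj (v' i) * v' i) = 1"
    using \<open>r > 0\<close> by (simp add: v'_def sum_divide_distrib[symmetric] rr flip: of_real_mult)
  have "orthonormal_on n {..<Suc m} (u(m := v'))"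
    using u norm orth unfolding orthonormal_on_def by (auto simp: less_Suc_eq)
  moreover have "(\<Sum>k<n. A i k * v' k) = of_real (Re a) * v' i" if "i < n" for i
    using v(3)[OF that] a by (simp add: v'_def sum_divide_distrib[symmetric])
  with eig have "\<forall>j<Suc m. \<forall>i<n. (\<Sum>k<n. A i k * (u(m := v')) j k) =
      of_real ((d(m := Re a)) j) * (u(m := v')) j i"
    by (auto simp: less_Suc_eq)
  ultimately show ?case by blast
qed

text \<open>The vectors are the columns of a square matrix whose conjugate transpose is a left
  inverse, hence also a right inverse. This later evaluates the trace of the flip in the basis
  \<open>u\<close>.\<close>

lemma orthonormal_on_complete:
  assumes u: "orthonormal_on n {..<n} u" and "i < n" "k < n"
  shows "(\<Sum>j<n. u j i * cnj (u j k)) = (if i = k then 1 else 0)"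
proof -
  define U where "U = Matrix.mat n n (\<lambda>(i, j). u j i)"
  define V where "V = Matrix.mat n n (\<lambda>(j, i). cnj (u j i))"
  have "V * U = 1\<^sub>m n"
    using u unfolding orthonormal_on_def
    by (intro eq_matI) (auto simp: U_def V_def scalar_prod_def lessThan_atLeast0)
  then have "U * V = 1\<^sub>m n"
    by (intro mat_mult_left_right_inverse[of V n U]) (simp_all add: U_def V_def)
  have "(\<Sum>j<n. u j i * cnj (u j k)) = (U * V) $$ (i, k)"
    using assms(2,3) by (simp add: U_def V_def scalar_prod_def lessThan_atLeast0)
  also have "\<dots> = (if i = k then 1 else 0)"
    unfolding \<open>U * V = 1\<^sub>m n\<close> using assms(2,3) by simp
  finally show ?thesis .
qed

text \<open>The unitary matrix with columns \<open>u j\<close> conjugates \<open>A\<close> to a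
  diagonal matrix, so the characteristic polynomial splits with the right multiplicities.\<close>

lemma proots_char_poly_orthonormal_eigenbasis:
  fixes A :: "complex mat"
  assumes A: "A \<in> carrier_mat n n"
    and u: "orthonormal_on n {..<n} u"
    and eig: "\<And>j i. j < n \<Longrightarrow> i < n \<Longrightarrow> (\<Sum>k<n. A $$ (i, k) * u j k) = d j * u j i"
  shows "proots (char_poly A) = image_mset d (mset_set {..<n})"
proof -
  define U where "U = Matrix.mat n n (\<lambda>(i, j). u j i)"
  define V where "V = Matrix.mat n n (\<lambda>(j, i). cnj (u j i))"
  define D where "D = Matrix.mat n n (\<lambda>(i, j). if i = j then d j else 0)"
  have carrier: "U \<in> carrier_mat n n" "V \<in> carrier_mat n n" "D \<in> carrier_mat n n"
    by (simp_all add: U_def V_def D_def)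
  have VU: "V * U = 1\<^sub>m n"
    using u unfolding orthonormal_on_def
    by (intro eq_matI) (auto simp: U_def V_def scalar_prod_def lessThan_atLeast0)
  have UV: "U * V = 1\<^sub>m n" by (rule mat_mult_left_right_inverse[OF carrier(2,1) VU])
  have AU: "A * U = U * D"
    using A eig by (intro eq_matI)
      (auto simp: U_def D_def scalar_prod_def lessThan_atLeast0 if_distrib[of "\<lambda>z. _ * z"]
        mult.commute cong: if_cong)
  have "A = A * (U * V)" unfolding UV using A by simp
  also have "\<dots> = U * D * V" by (simp only: assoc_mult_mat[OF A carrier(1,2), symmetric] AU)
  finally have "similar_mat A D"
    unfolding similar_mat_def similar_mat_wit_def Let_def
    using A carrier UV VU by (intro exI[of _ U] exI[of _ V]) auto
  then have "char_poly A = char_poly D" by (rule char_poly_similar)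
  also have "\<dots> = (\<Prod>a\<leftarrow>diag_mat D. [:- a, 1:])"
    by (rule char_poly_upper_triangular[OF carrier(3)]) (auto simp: D_def)
  also have "diag_mat D = map d [0..<n]"
    by (auto simp: diag_mat_def D_def)
  also have "(\<Prod>a\<leftarrow>map d [0..<n]. [:- a, 1:]) = (\<Prod>j<n. [:- d j, 1:])"
    using prod.distinct_set_conv_list[of "[0..<n]" "\<lambda>j. [:- d j, 1:]"]
    by (simp add: lessThan_atLeast0 o_def)
  finally have "proots (char_poly A) = (\<Sum>j<n. {#d j#})"
    by (simp add: proots_prod)
  also have "\<dots> = image_mset d (mset_set {..<n})"
    by (induction n) (auto simp: lessThan_Suc)
  finally show ?thesis .
qed

section \<open>Symbols, nodes and enumerations\<close>

lemma card_nodes_below: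
  assumes "0 \<le> t"
  shows "real (card {k. k \<le> N \<and> node N (int k) < t}) \<le> t * (2 * real N + 1) / (2 * pi) + 1"
proof -
  \<comment> \<open>\<open>x\<close> is \<open>t\<close> in units of the node spacing: node
    \<open>k\<close> lies below \<open>t\<close> exactly if \<open>k\<close> is below
    \<open>x\<close>.\<close>
  define x where "x = t * (2 * real N + 1) / (2 * pi)"
  have "x \<ge> 0" using assms by (simp add: x_def)
  have "k < nat \<lceil>x\<rceil>" if "node N (int k) < t" for k
  proof -
    have "real k < x" using that pi_gt_zero by (simp add: node_def x_def field_simps)
    then show ?thesis by linarith
  qed
  then have "{k. k \<le> N \<and> node N (int k) < t} \<subseteq> {..<nat \<lceil>x\<rceil>}"
    by auto
  then have "card {k. k \<le> N \<and> node N (int k) < t} \<le> nat \<lceil>x\<rceil>"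
    using card_mono[of "{..<nat \<lceil>x\<rceil>}"] by simp
  also have "real (nat \<lceil>x\<rceil>) \<le> x + 1" using \<open>x \<ge> 0\<close> by linarith
  finally show ?thesis by (simp add: x_def)
qed

lemma card_nodes_above:
  assumes "0 \<le> t" "t \<le> pi"
  shows "real (card {k. k \<le> N \<and> t < node N (int k)}) \<le> real N - t * (2 * real N + 1) / (2 * pi) + 1"
proof -
  define x where "x = t * (2 * real N + 1) / (2 * pi)"
  have "x \<ge> 0" using assms by (simp add: x_def)
  have "t * (2 * real N + 1) \<le> pi * (2 * real N + 1)" using assms by (intro mult_right_mono) auto
  \<comment> \<open>This keeps the floor of \<open>x\<close> at most \<open>N\<close>, so that the
    subtraction of naturals below is not truncated.\<close>
  then have "x \<le> real N + 1 / 2" by (simp add: x_def field_simps)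
  have "nat \<lfloor>x\<rfloor> < k" if "t < node N (int k)" for k
  proof -
    have "x < real k" using that pi_gt_zero by (simp add: node_def x_def field_simps)
    with \<open>x \<ge> 0\<close> show ?thesis by linarith
  qed
  then have "{k. k \<le> N \<and> t < node N (int k)} \<subseteq> {nat \<lfloor>x\<rfloor><..N}"
    by auto
  then have "card {k. k \<le> N \<and> t < node N (int k)} \<le> N - nat \<lfloor>x\<rfloor>"
    using card_mono[of "{nat \<lfloor>x\<rfloor><..N}"] by simp
  also have "real (N - nat \<lfloor>x\<rfloor>) \<le> real N - x + 1"
    using \<open>x \<ge> 0\<close> \<open>x \<le> real N + 1 / 2\<close> by linarith
  finally show ?thesis by (simp add: x_def)
qed

text \<open>The increment f (x + \<delta>) - f x is continuous and positive on a compact interval,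
  so it has a positive minimum; half of it makes the inequality strict. If \<delta> exceeds the
  length of the interval, no pair qualifies.\<close>

lemma uniform_increase:
  fixes f :: "real \<Rightarrow> real"
  assumes cont: "continuous_on {a..b} f" and mono: "strict_mono_on {a..b} f" and "\<delta> > 0"
  obtains \<epsilon> where "\<epsilon> > 0"
    "\<And>x y. x \<in> {a..b} \<Longrightarrow> y \<in> {a..b} \<Longrightarrow> x + \<delta> \<le> y \<Longrightarrow> f x + \<epsilon> < f y"
proof (cases "a + \<delta> \<le> b")
  case False
  then show ?thesis using that[of 1] by auto
next
  case True
  have "continuous_on {a..b - \<delta>} (\<lambda>x. f (x + \<delta>) - f x)"
    using assms(3) by (intro continuous_intros continuous_on_compose2[OF cont]) auto
  moreover have "{a..b - \<delta>} \<noteq> {}" using True by simp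
  ultimately obtain x0 where x0: "x0 \<in> {a..b - \<delta>}"
    "\<And>x. x \<in> {a..b - \<delta>} \<Longrightarrow> f (x0 + \<delta>) - f x0 \<le> f (x + \<delta>) - f x"
    using continuous_attains_inf[OF compact_Icc] by blast
  define \<epsilon> where "\<epsilon> = (f (x0 + \<delta>) - f x0) / 2"
  have "f x0 < f (x0 + \<delta>)"
    using x0(1) \<open>\<delta> > 0\<close> by (intro strict_mono_onD[OF mono]) auto
  then have "\<epsilon> > 0" by (simp add: \<epsilon>_def)
  moreover have "f x + \<epsilon> < f y" if "x \<in> {a..b}" "y \<in> {a..b}" "x + \<delta> \<le> y" for x y
  proof -
    have "2 * \<epsilon> \<le> f (x + \<delta>) - f x" using x0(2)[of x] that by (simp add: \<epsilon>_def)
    moreover have "f (x + \<delta>) \<le> f y"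
      using that \<open>\<delta> > 0\<close> by (intro strict_mono_on_leD[OF mono]) auto
    ultimately show ?thesis using \<open>\<epsilon> > 0\<close> by linarith
  qed
  ultimately show ?thesis using that by blast
qed

text \<open>Weierstrass approximation of f composed with arccos on [-1, 1]. Evenness covers negative
  x, since arccos (cos x) is |x|.\<close>

lemma even_approx_cos_polynomial:
  fixes f :: "real \<Rightarrow> real"
  assumes cont: "continuous_on {-pi..pi} f" and even: "\<And>x. x \<in> {-pi..pi} \<Longrightarrow> f (- x) = f x"
    and "\<epsilon> > 0"
  shows "\<exists>m a. \<forall>x\<in>{-pi..pi}. \<bar>f x - (\<Sum>i\<le>m. a i * cos x ^ i)\<bar> \<le> \<epsilon>"
proof -
  have "continuous_on {-1..1} (\<lambda>y. f (arccos y))"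
  proof (rule continuous_on_compose2[OF cont])
    show "continuous_on {-1..1} arccos" by (rule continuous_on_arccos')
    have "arccos y \<in> {-pi..pi}" if "y \<in> {-1..1}" for y
      using that arccos_lbound[of y] arccos_ubound[of y] pi_gt_zero by auto
    then show "arccos ` {-1..1} \<subseteq> {-pi..pi}" by blast
  qed
  then obtain g where g: "real_polynomial_function g"
    "\<And>y. y \<in> {-1..1} \<Longrightarrow> \<bar>f (arccos y) - g y\<bar> < \<epsilon>"
    using Stone_Weierstrass_real_polynomial_function[of "{-1..1}" "\<lambda>y. f (arccos y)" \<epsilon>] \<open>\<epsilon> > 0\<close>
    by auto
  obtain a m where g_eq: "g = (\<lambda>x. \<Sum>i\<le>m. a i * x ^ i)"
    using g(1) unfolding real_polynomial_function_iff_sum by blast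
  have "\<bar>f x - (\<Sum>i\<le>m. a i * cos x ^ i)\<bar> \<le> \<epsilon>" if "x \<in> {-pi..pi}" for x
  proof -
    have "arccos (cos x) = \<bar>x\<bar>"
      using that arccos_cos[of "\<bar>x\<bar>"] by (simp add: abs_le_iff)
    then have "f (arccos (cos x)) = f x" using even[OF that] by (simp add: abs_if)
    with g(2)[of "cos x"] show ?thesis by (simp add: g_eq)
  qed
  then show ?thesis by blast
qed

lemma sorted_enumeration:
  fixes e :: "'a \<Rightarrow> 'b :: linorder"
  assumes "finite J"
  shows "\<exists>g. bij_betw g {1..card J} J \<and> mono_on {1..card J} (\<lambda>i. e (g i))"
proof -
  obtain ys where ys: "set ys = J" "distinct ys"
    using finite_distinct_list[OF assms] by blast
  define xs where "xs = sort_key e ys"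
  have xs: "set xs = J" "distinct xs" "sorted (map e xs)" by (simp_all add: xs_def ys)
  have len: "length xs = card J" using xs distinct_card by metis
  define g where "g i = xs ! (i - 1)" for i
  have "bij_betw (\<lambda>i. i - 1) {1..card J} {..<length xs}"
    by (rule bij_betwI[of _ _ _ Suc]) (auto simp: len)
  from bij_betw_trans[OF this bij_betw_nth[OF xs(2) refl xs(1)[symmetric]]]
  have "bij_betw g {1..card J} J" by (simp add: g_def[abs_def] o_def)
  moreover have "e (g a) \<le> e (g b)" if "1 \<le> a" "a \<le> b" "b \<le> card J" for a b
    using sorted_nth_mono[OF xs(3), of "a - 1" "b - 1"] that len by (simp add: g_def)
  then have "mono_on {1..card J} (\<lambda>i. e (g i))" by (intro mono_onI) auto
  ultimately show ?thesis by blast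
qed

section \<open>Toeplitz and Hankel matrices of a monotone symbol\<close>

locale toeplitz_symbol =
  fixes f :: "real \<Rightarrow> real"
  assumes cont: "continuous_on {-pi..pi} f"
    and even: "\<And>x. x \<in> {-pi..pi} \<Longrightarrow> f (- x) = f x"
    and pos: "\<And>x. x \<in> {0..pi} \<Longrightarrow> f x > 0"
    and mono: "strict_mono_on {0..pi} f"
begin

definition c :: "int \<Rightarrow> complex" where
  "c = fourier_coeff (\<lambda>x. of_real (f x))"

section \<open>Symmetry of the coefficients, bounds of the form, and the joint eigenbasis\<close>

lemma cont0: "continuous_on {0..pi} f"
  using cont by (rule continuous_on_subset) auto

lemma c_even: "c (- k) = c k"
proof -
  have "integral {-pi..pi} (\<lambda>x. of_real (f x) * cis (of_int (- k) * x)) =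
      integral {-pi..pi} (\<lambda>x. of_real (f (- x)) * cis (of_int (- k) * (- x)))"
    using Henstock_Kurzweil_Integration.integral_reflect_real[of pi "-pi" "\<lambda>x. of_real (f x) * cis (of_int (- k) * x)"]
    by simp
  also have "\<dots> = integral {-pi..pi} (\<lambda>x. of_real (f x) * cis (of_int k * x))"
    using even by (intro integral_cong) auto
  finally show ?thesis
    unfolding c_def fourier_coeff_eq_integral[OF cont] by simp
qed

lemma cnj_c: "cnj (c k) = c k"
proof -
  have "cnj (c k) = c (- k)"
    unfolding c_def fourier_coeff_eq_integral[OF cont] complex_cnj_divide integral_cnj
    by (simp add: cis_cnj)
  then show ?thesis by (simp add: c_even)
qed

lemma f_bounds:
  assumes "x \<in> {-pi..pi}"
  shows "f 0 \<le> f x" "f x \<le> f pi"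
proof -
  have "f x = f \<bar>x\<bar>" using even[OF assms] by (simp add: abs_if)
  moreover have "f 0 \<le> f \<bar>x\<bar>" "f \<bar>x\<bar> \<le> f pi"
    using assms by (auto intro!: strict_mono_on_leD[OF mono] simp: abs_le_iff)
  ultimately show "f 0 \<le> f x" "f x \<le> f pi" by simp_all
qed

text \<open>The form is the mean of f |V|^2, which Parseval compares with the squared norm. The
  lower bound yields positive definiteness; both together confine the eigenvalues to the range of
  f.\<close>

lemma form_bounds:
  obtains r where "(\<Sum>s<n. cnj (v s) * (\<Sum>t<n. c (int s - int t) * v t)) = of_real r"
    "f 0 * (\<Sum>t<n. (norm (v t))\<^sup>2) \<le> r" "r \<le> f pi * (\<Sum>t<n. (norm (v t))\<^sup>2)"
proof -
  let ?V = "\<lambda>x. (norm (trig_sum n v x))\<^sup>2"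
  let ?r = "integral {-pi..pi} (\<lambda>x. f x * ?V x) / (2 * pi)"
  have int: "(\<lambda>x. b * ?V x) integrable_on {-pi..pi}" "(\<lambda>x. f x * ?V x) integrable_on {-pi..pi}" for b
    by (intro integrable_continuous_real continuous_intros cont)+
  have "integral {-pi..pi} (\<lambda>x. f 0 * ?V x) \<le> integral {-pi..pi} (\<lambda>x. f x * ?V x)"
    "integral {-pi..pi} (\<lambda>x. f x * ?V x) \<le> integral {-pi..pi} (\<lambda>x. f pi * ?V x)"
    by (intro integral_le int mult_right_mono f_bounds; simp)+
  then have "f 0 * (\<Sum>t<n. (norm (v t))\<^sup>2) \<le> ?r" "?r \<le> f pi * (\<Sum>t<n. (norm (v t))\<^sup>2)"
    by (simp_all add: parseval_trig_sum field_simps)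
  moreover have "(\<Sum>s<n. cnj (v s) * (\<Sum>t<n. c (int s - int t) * v t)) = of_real ?r"
    unfolding toeplitz_form[OF cont, symmetric] c_def by (simp add: sum_distrib_left mult.assoc)
  ultimately show ?thesis using that by blast
qed

text \<open>Starting from an eigenbasis of H rather than of T gives vectors with a definite symmetry
  even if an eigenvalue of T were shared by both symmetry classes. The flip Y appears as the index
  map sending \<open>i\<close> to \<open>n - 1 - i\<close>.\<close>

lemma spectral_decomposition:
  "\<exists>(u :: nat \<Rightarrow> nat \<Rightarrow> complex) (d :: nat \<Rightarrow> real). orthonormal_on n {..<n} u \<and>
    (\<forall>j<n. d j \<noteq> 0 \<and> \<bar>d j\<bar> \<in> {f 0..f pi}) \<and>
    (\<forall>j<n. \<forall>i<n. (\<Sum>k<n. c (int i - int k) * u j k) = of_real \<bar>d j\<bar> * u j i \<and>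
      (\<Sum>k<n. c (int (n - 1 - i) - int k) * u j k) = of_real (d j) * u j i \<and>
      u j (n - 1 - i) = of_real (sgn (d j)) * u j i)"
proof -
  have "\<exists>u d. orthonormal_on n {..<n} u \<and>
      (\<forall>j<n. \<forall>i<n. (\<Sum>k<n. c (int (n - 1 - i) - int k) * u j k) = complex_of_real (d j) * u j i)"
    by (rule hermitian_orthonormal_eigenvectors[of n "\<lambda>i k. c (int (n - 1 - i) - int k)"])
       (simp_all add: cnj_c algebra_simps)
  then obtain u d where u: "orthonormal_on n {..<n} u"
    and eig: "\<And>j i. j < n \<Longrightarrow> i < n \<Longrightarrow> (\<Sum>k<n. c (int (n - 1 - i) - int k) * u j k) = of_real (d j) * u j i"
    by blast
  define T where "T v i = (\<Sum>k<n. c (int i - int k) * v k)" for v i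
  \<comment> \<open>The eigenvalue equation of H read at row \<open>n - 1 - i\<close>, that is T u =
    d Y u.\<close>
  have T1: "T (u j) i = of_real (d j) * u j (n - 1 - i)" if "j < n" "i < n" for i j
    using eig[OF that(1), of "n - 1 - i"] that by (simp add: T_def)
  \<comment> \<open>As \<open>c\<close> is even, applying T to Y u is applying H to u, which
    contributes the second factor d.\<close>
  have T2: "T (T (u j)) i = of_real ((d j)\<^sup>2) * u j i" if "j < n" "i < n" for i j
  proof -
    have "T (T (u j)) i = (\<Sum>k<n. c (int i - int k) * (of_real (d j) * u j (n - 1 - k)))"
      using T1[OF that(1)] unfolding T_def[of "T (u j)"] by simp
    also have "\<dots> = (\<Sum>k<n. c (int i - int (n - 1 - k)) * (of_real (d j) * u j k))"
      by (rule sum.reindex_bij_witness[of _ "\<lambda>k. n - 1 - k" "\<lambda>k. n - 1 - k"]) auto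
    also have "\<dots> = (\<Sum>k<n. of_real (d j) * (c (int (n - 1 - i) - int k) * u j k))"
    proof (intro sum.cong refl)
      fix k assume "k \<in> {..<n}"
      then have "int i - int (n - 1 - k) = - (int (n - 1 - i) - int k)"
        using that by (simp add: of_nat_diff)
      then show "c (int i - int (n - 1 - k)) * (of_real (d j) * u j k) =
          of_real (d j) * (c (int (n - 1 - i) - int k) * u j k)"
        by (simp only: c_even mult.left_commute)
    qed
    also have "\<dots> = of_real ((d j)\<^sup>2) * u j i"
      using eig[OF that] by (simp add: sum_distrib_left[symmetric] power2_eq_square mult.assoc)
    finally show ?thesis .
  qed
  have f0: "f 0 > 0" by (rule pos) simp
  have T3: "T (u j) i = of_real \<bar>d j\<bar> * u j i" if "j < n" "i < n" for i j
  proof -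
    \<comment> \<open>From T^2 u = d^2 u follows T w = - |d| w, and positive definiteness then
      forces w = 0.\<close>
    define w where "w i = T (u j) i - of_real \<bar>d j\<bar> * u j i" for i
    have Tw: "T w s = - of_real \<bar>d j\<bar> * w s" if "s < n" for s
    proof -
      have "T w s = T (T (u j)) s - of_real \<bar>d j\<bar> * T (u j) s"
        unfolding T_def[of w] w_def
        by (simp add: T_def[of "T (u j)"] T_def[of "u j" s] algebra_simps sum_subtractf sum_distrib_left)
      also have "\<dots> = - of_real \<bar>d j\<bar> * w s"
        using T2[OF \<open>j < n\<close> that]
        by (simp add: w_def algebra_simps power2_eq_square flip: of_real_mult)
      finally show ?thesis .
    qed
    define S where "S = (\<Sum>t<n. (norm (w t))\<^sup>2)"
    obtain r where r: "(\<Sum>s<n. cnj (w s) * (\<Sum>t<n. c (int s - int t) * w t)) = of_real r"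
      "f 0 * S \<le> r" "r \<le> f pi * S" unfolding S_def by (rule form_bounds)
    have "of_real r = (\<Sum>s<n. - of_real \<bar>d j\<bar> * (cnj (w s) * w s))"
      unfolding r(1)[symmetric] T_def[symmetric] using Tw by (intro sum.cong) (auto simp: mult_ac)
    also have "\<dots> = of_real (- \<bar>d j\<bar> * S)"
      unfolding S_def of_real_mult of_real_sum complex_norm_square sum_distrib_left
      by (simp add: mult_ac)
    finally have "r = - \<bar>d j\<bar> * S" by (simp only: of_real_eq_iff)
    moreover have "S \<ge> 0" by (simp add: S_def sum_nonneg)
    ultimately have "f 0 * S \<le> 0"
      using r(2) mult_nonneg_nonneg[of "\<bar>d j\<bar>" S] by linarith
    with f0 \<open>S \<ge> 0\<close> have "S = 0" by (simp add: mult_le_0_iff)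
    then have "w i = 0" using \<open>i < n\<close> by (simp add: S_def sum_nonneg_eq_0_iff)
    then show ?thesis by (simp add: w_def)
  qed
  have d_bounds: "\<bar>d j\<bar> \<in> {f 0..f pi}" if "j < n" for j
  proof -
    have uu: "(\<Sum>i<n. cnj (u j i) * u j i) = 1" using u that by (simp add: orthonormal_on_def)
    have "complex_of_real (\<Sum>t<n. (norm (u j t))\<^sup>2) = of_real 1"
      unfolding of_real_sum complex_norm_square mult.commute[of _ "cnj _"] uu by simp
    then have nu: "(\<Sum>t<n. (norm (u j t))\<^sup>2) = 1" by (simp only: of_real_eq_iff)
    obtain r where r: "(\<Sum>s<n. cnj (u j s) * (\<Sum>t<n. c (int s - int t) * u j t)) = of_real r"
      "f 0 * (\<Sum>t<n. (norm (u j t))\<^sup>2) \<le> r" "r \<le> f pi * (\<Sum>t<n. (norm (u j t))\<^sup>2)"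
      by (rule form_bounds)
    have "of_real r = (\<Sum>s<n. of_real \<bar>d j\<bar> * (cnj (u j s) * u j s))"
      unfolding r(1)[symmetric] T_def[symmetric] using T3[OF that]
      by (intro sum.cong) (auto simp: mult_ac)
    also have "\<dots> = of_real \<bar>d j\<bar>" unfolding sum_distrib_left[symmetric] uu by simp
    finally have "r = \<bar>d j\<bar>" by (simp only: of_real_eq_iff)
    with r(2,3) nu show ?thesis by simp
  qed
  have d_nz: "d j \<noteq> 0" if "j < n" for j using d_bounds[OF that] f0 by auto
  have flip: "u j (n - 1 - i) = of_real (sgn (d j)) * u j i" if "j < n" "i < n" for i j
  proof -
    have "of_real (d j) * u j (n - 1 - i) = of_real (\<bar>d j\<bar>) * u j i"
      using T1[OF that] T3[OF that] by simp
    also have "\<bar>d j\<bar> = d j * sgn (d j)" by (simp add: abs_sgn)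
    finally show ?thesis using d_nz[OF \<open>j < n\<close>] by simp
  qed
  show ?thesis
    using u d_nz T3[unfolded T_def] flip eig d_bounds by blast
qed

section \<open>Location of the eigenvalues within one symmetry class\<close>

definition eigenfamily where
  "eigenfamily n s J u e \<longleftrightarrow> finite J \<and> orthonormal_on n J u \<and>
     (\<forall>j\<in>J. \<forall>i<n. u j (n - 1 - i) = s * u j i) \<and>
     (\<forall>j\<in>J. \<forall>i<n. (\<Sum>k<n. c (int i - int k) * u j k) = complex_of_real (e j) * u j i)"

text \<open>\<open>C\<close> serves all sizes, families and enumerations at once. A symmetry class
  has about n / 2 members, which makes 2 pi j / n the expected place of its j-th eigenvalue. Naming
  the predicate allows \<open>C\<close> to be chosen as a function of \<delta>.\<close>

definition location_bound :: "real \<Rightarrow> real \<Rightarrow> bool" where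
  "location_bound \<delta> C \<longleftrightarrow> (\<forall>n s (J :: nat set) u e g j t.
     n \<ge> 1 \<longrightarrow> eigenfamily n s J u e \<longrightarrow>
     bij_betw g {1..card J} J \<longrightarrow> mono_on {1..card J} (\<lambda>i. e (g i)) \<longrightarrow>
     n \<le> 2 * card J + 1 \<longrightarrow> 2 * card J \<le> n + 1 \<longrightarrow>
     j \<in> {1..card J} \<longrightarrow> t \<in> {0..pi} \<longrightarrow> f t = e (g j) \<longrightarrow>
     \<bar>t - 2 * pi * real j / real n\<bar> \<le> \<delta> + C / real n)"

text \<open>The first j eigenvalues of the class are at most f t, which is below
  \<open>f (t + \<delta>)\<close> by more than \<epsilon>, so j is at most the number of nonnegative
  nodes below \<open>t + \<delta>\<close>, about (t + \<delta>) n / (2 pi). Counting from the j-th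
  eigenvalue upwards with \<open>- f\<close> gives the other side.\<close>

lemma eigenvalue_location:
  assumes "\<delta> > 0"
  shows "\<exists>C. location_bound \<delta> C"
proof -
  obtain \<epsilon> where \<epsilon>: "\<epsilon> > 0"
    "\<And>x y. x \<in> {0..pi} \<Longrightarrow> y \<in> {0..pi} \<Longrightarrow> x + \<delta> \<le> y \<Longrightarrow> f x + \<epsilon> < f y"
    using uniform_increase[OF cont0 mono assms] by blast
  have "\<exists>m a. \<forall>x\<in>{-pi..pi}. \<bar>f x - (\<Sum>i\<le>m. a i * cos x ^ i)\<bar> \<le> \<epsilon> / 2"
    by (rule even_approx_cos_polynomial) (use cont even \<epsilon>(1) in auto)
  then obtain m a where "\<forall>x\<in>{-pi..pi}. \<bar>f x - (\<Sum>i\<le>m. a i * cos x ^ i)\<bar> \<le> \<epsilon> / 2"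
    by blast
  then have approx: "\<bar>f x - (\<Sum>i\<le>m. a i * cos x ^ i)\<bar> \<le> \<epsilon> / 2" if "x \<in> {-pi..pi}" for x
    using that by blast
  \<comment> \<open>Of \<open>m + 3\<close>, the part \<open>m + 1\<close> pays for
    \<open>2 * N + 1 \<le> n + m + 1\<close> and the remaining 2 for rounding in the node
    count.\<close>
  define C where "C = pi * (real m + 3)"
  have "location_bound \<delta> C"
    unfolding location_bound_def
  proof (intro allI impI)
    fix n s and J :: "nat set" and u e g j t
    assume n: "n \<ge> 1" and fam: "eigenfamily n s J u e"
      and g: "bij_betw g {1..card J} J" and e_mono: "mono_on {1..card J} (\<lambda>i. e (g i))"
      and card: "n \<le> 2 * card J + 1" "2 * card J \<le> n + 1"
      and j: "j \<in> {1..card J}" and t: "t \<in> {0..pi}" "f t = e (g j)"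
    have J: "finite J" and u: "orthonormal_on n J u"
      and sym: "\<And>j i. j \<in> J \<Longrightarrow> i < n \<Longrightarrow> u j (n - 1 - i) = s * u j i"
      and eig: "\<And>j i. j \<in> J \<Longrightarrow> i < n \<Longrightarrow> (\<Sum>k<n. c (int i - int k) * u j k) = of_real (e j) * u j i"
      using fam unfolding eigenfamily_def by (blast, blast, blast, blast)
    \<comment> \<open>The coarsest rule exact for degree \<open>m\<close>: the least
      \<open>N\<close> with \<open>n + m \<le> 2 * N + 1\<close>.\<close>
    define N where "N = (n + m) div 2"
    have N: "n + m \<le> 2 * N + 1" "2 * N \<le> n + m" by (auto simp: N_def)
    have g_J: "g i \<in> J" if "i \<in> {1..card J}" for i using bij_betwE[OF g] that by blast
    have card_g: "card (g ` I) = card I" if "I \<subseteq> {1..card J}" for I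
      by (rule card_image[OF inj_on_subset[OF bij_betw_imp_inj_on[OF g] that]])
    have node: "node N (int k) \<in> {0..pi}" if "k \<le> N" for k
      using node_bounds[of "int k" N] that by (simp add: node_def)
    have n0: "real n > 0" using n by simp
    have lower: "2 * pi * real j / real n \<le> t + (\<delta> + C / real n)"
    proof (cases "t + \<delta> \<le> pi")
      case True
      have t': "t + \<delta> \<in> {0..pi}" using True t assms by auto
      define K where "K = {k. k \<le> N \<and> node N (int k) < t + \<delta>}"
      have "card (g ` {1..j}) \<le> card K"
      proof (rule card_eigenvalues_le_card_nodes[where f = f and u = u and e = e and s = s and m = m
            and a = a and \<epsilon> = "\<epsilon> / 2" and b = "f (t + \<delta>)" and N = N and n = n])
        have sub: "g ` {1..j} \<subseteq> J" using g_J j by auto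
        then show "orthonormal_on n (g ` {1..j}) u" by (rule orthonormal_on_subset[OF u])
        show "u l (n - 1 - i) = s * u l i" if "l \<in> g ` {1..j}" "i < n" for l i
          using sym sub that by blast
        show "(\<Sum>k<n. fourier_coeff (\<lambda>x. of_real (f x)) (int i - int k) * u l k) = of_real (e l) * u l i"
          if "l \<in> g ` {1..j}" "i < n" for l i
          using eig sub that unfolding c_def by blast
        show "e l < f (t + \<delta>) - 2 * (\<epsilon> / 2)" if "l \<in> g ` {1..j}" for l
        proof -
          have "e l \<le> f t" using that j unfolding t(2) by (auto intro: mono_onD[OF e_mono])
          with \<epsilon>(2)[OF t(1) t'] show ?thesis by simp
        qed
        show "f (t + \<delta>) \<le> f (node N (int k))" if "k \<le> N" "k \<notin> K" for k
          using that node[OF that(1)] t' by (intro strict_mono_on_leD[OF mono]) (auto simp: K_def)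
      qed (use cont even approx N in \<open>auto simp: K_def\<close>)
      then have "real j \<le> real (card K)" using card_g[of "{1..j}"] j by simp
      also have "\<dots> \<le> (t + \<delta>) * (2 * real N + 1) / (2 * pi) + 1"
        unfolding K_def using t' by (intro card_nodes_below) auto
      finally have "2 * pi * real j \<le> (t + \<delta>) * (2 * real N + 1) + 2 * pi"
        by (simp add: field_simps)
      also have "(t + \<delta>) * (2 * real N + 1) \<le> (t + \<delta>) * (real n + real m + 1)"
        using N(2) t' by (intro mult_left_mono) auto
      also have "\<dots> = (t + \<delta>) * real n + (t + \<delta>) * (real m + 1)" by (simp add: algebra_simps)
      also have "(t + \<delta>) * (real m + 1) \<le> pi * (real m + 1)"
        using True by (intro mult_right_mono) auto
      finally have "2 * pi * real j \<le> (t + \<delta>) * real n + C" by (simp add: C_def algebra_simps)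
      then show ?thesis using n0 by (simp add: field_simps)
    next
      \<comment> \<open>Here \<open>t + \<delta>\<close> exceeds pi, and the size of the class,
        \<open>2 * j \<le> n + 1\<close>, already suffices.\<close>
      case False
      have "2 * real j \<le> real n + 1" using j card(2) by simp
      then have "pi * (2 * real j) \<le> pi * (real n + 1)" by (intro mult_left_mono) auto
      also have "\<dots> \<le> pi * real n + C" by (simp add: C_def algebra_simps)
      also have "pi * real n \<le> (t + \<delta>) * real n" using False by (intro mult_right_mono) auto
      finally show ?thesis using n0 by (simp add: field_simps)
    qed
    have upper: "t \<le> 2 * pi * real j / real n + (\<delta> + C / real n)"
    proof (cases "0 \<le> t - \<delta>")
      case True
      have t': "t - \<delta> \<in> {0..pi}" using True t assms by auto
      \<comment> \<open>Negating the symbol turns the largest eigenvalues into the smallest, so V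
        must now vanish at the nodes above \<open>t - \<delta>\<close>.\<close>
      define K where "K = {k. k \<le> N \<and> t - \<delta> < node N (int k)}"
      have "card (g ` {j..card J}) \<le> card K"
      proof (rule card_eigenvalues_le_card_nodes[where f = "\<lambda>x. - f x" and u = u and e = "\<lambda>l. - e l"
            and s = s and m = m and a = "\<lambda>i. - a i" and \<epsilon> = "\<epsilon> / 2" and b = "- f (t - \<delta>)"
            and N = N and n = n])
        have sub: "g ` {j..card J} \<subseteq> J" using g_J j by auto
        then show "orthonormal_on n (g ` {j..card J}) u" by (rule orthonormal_on_subset[OF u])
        show "u l (n - 1 - i) = s * u l i" if "l \<in> g ` {j..card J}" "i < n" for l i
          using sym sub that by blast
        have neg: "fourier_coeff (\<lambda>x. of_real (- f x)) k = - c k" for k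
          unfolding c_def fourier_coeff_eq_integral[OF cont]
            fourier_coeff_eq_integral[OF continuous_on_minus[OF cont]]
          by simp
        show "(\<Sum>k<n. fourier_coeff (\<lambda>x. of_real (- f x)) (int i - int k) * u l k) =
            of_real (- e l) * u l i"
          if "l \<in> g ` {j..card J}" "i < n" for l i
          using eig[of l i] sub that unfolding neg by (auto simp: sum_negf)
        show "- e l < - f (t - \<delta>) - 2 * (\<epsilon> / 2)" if "l \<in> g ` {j..card J}" for l
        proof -
          have "f t \<le> e l" using that j unfolding t(2) by (auto intro: mono_onD[OF e_mono])
          with \<epsilon>(2)[OF t' t(1)] show ?thesis by simp
        qed
        show "- f (t - \<delta>) \<le> - f (node N (int k))" if "k \<le> N" "k \<notin> K" for k
        proof -
          have "f (node N (int k)) \<le> f (t - \<delta>)"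
            using that node[OF that(1)] t' by (intro strict_mono_on_leD[OF mono]) (auto simp: K_def)
          then show ?thesis by simp
        qed
        show "\<bar>- f x - (\<Sum>i\<le>m. - a i * cos x ^ i)\<bar> \<le> \<epsilon> / 2" if "x \<in> {-pi..pi}" for x
          using approx[OF that] by (simp add: sum_negf abs_minus_commute)
      qed (use cont even N in \<open>auto simp: K_def intro: continuous_on_minus\<close>)
      then have "real (card J + 1 - j) \<le> real (card K)" using card_g[of "{j..card J}"] j by simp
      also have "\<dots> \<le> real N - (t - \<delta>) * (2 * real N + 1) / (2 * pi) + 1"
        unfolding K_def using t' by (intro card_nodes_above) auto
      finally have "(t - \<delta>) * (2 * real N + 1) / (2 * pi) \<le> real N - real (card J) + real j"
        using j by (simp add: of_nat_diff)
      then have "(t - \<delta>) * (2 * real N + 1) \<le> pi * (2 * (real N - real (card J) + real j))"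
        by (simp add: field_simps)
      \<comment> \<open>From \<open>2 * N \<le> n + m\<close> and
        \<open>n \<le> 2 * card J + 1\<close>, twice the difference of \<open>N\<close> and
        \<open>card J\<close> is at most \<open>m + 1\<close>.\<close>
      also have "\<dots> \<le> pi * (real m + 1 + 2 * real j)"
        using card(1) N(2) by (intro mult_left_mono) auto
      also have "\<dots> \<le> C + 2 * pi * real j" by (simp add: C_def algebra_simps)
      finally have "(t - \<delta>) * (2 * real N + 1) \<le> C + 2 * pi * real j" .
      moreover have "(t - \<delta>) * real n \<le> (t - \<delta>) * (2 * real N + 1)"
        using N(1) True by (intro mult_left_mono) auto
      ultimately have "(t - \<delta>) * real n \<le> C + 2 * pi * real j" by linarith
      then have "t - \<delta> \<le> (C + 2 * pi * real j) / real n"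
        using n0 by (simp only: pos_le_divide_eq)
      then show ?thesis by (simp add: add_divide_distrib)
    next
      case False
      moreover have "0 \<le> 2 * pi * real j / real n" "0 \<le> C / real n" by (simp_all add: C_def)
      ultimately show ?thesis by linarith
    qed
    from lower upper show "\<bar>t - 2 * pi * real j / real n\<bar> \<le> \<delta> + C / real n" by linarith
  qed
  then show ?thesis ..
qed

text \<open>The sum of the signs is the trace of the flip in the basis \<open>u\<close>. By
  completeness it equals the number of fixed points of the map from \<open>i\<close> to
  \<open>n - 1 - i\<close>, which is 1 for odd and 0 for even \<open>n\<close>; the two
  cardinalities follow from their sum and difference.\<close>

lemma card_sign_classes:
  fixes u :: "nat \<Rightarrow> nat \<Rightarrow> complex" and d :: "nat \<Rightarrow> real"
  assumes u: "orthonormal_on n {..<n} u"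
    and d: "\<And>j. j < n \<Longrightarrow> d j \<noteq> 0"
    and flip: "\<And>j i. j < n \<Longrightarrow> i < n \<Longrightarrow> u j (n - 1 - i) = of_real (sgn (d j)) * u j i"
  shows "card {j. j < n \<and> d j > 0} = (n + 1) div 2" "card {j. j < n \<and> d j < 0} = n div 2"
proof -
  let ?P = "{j. j < n \<and> d j > 0}" and ?Q = "{j. j < n \<and> d j < 0}"
  have split: "{..<n} = ?P \<union> ?Q" "?P \<inter> ?Q = {}" using d by (auto simp: neq_iff)
  have "finite ?P" "finite ?Q" by simp_all
  from card_Un_disjoint[OF this split(2)] have sum: "card ?P + card ?Q = n"
    unfolding split(1)[symmetric] by simp
  have uu: "(\<Sum>i<n. cnj (u j i) * u j i) = 1" if "j < n" for j
    using u that by (simp add: orthonormal_on_def)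
  have "complex_of_real (\<Sum>j<n. sgn (d j)) = (\<Sum>j<n. of_real (sgn (d j)) * (\<Sum>i<n. cnj (u j i) * u j i))"
    by (simp add: uu)
  also have "\<dots> = (\<Sum>j<n. \<Sum>i<n. u j (n - 1 - i) * cnj (u j i))"
    unfolding sum_distrib_left using flip by (intro sum.cong) (auto simp: mult_ac)
  also have "\<dots> = (\<Sum>i<n. \<Sum>j<n. u j (n - 1 - i) * cnj (u j i))" by (rule sum.swap)
  also have "\<dots> = (\<Sum>i<n. if n - 1 - i = i then 1 else 0)"
    by (intro sum.cong refl orthonormal_on_complete[OF u]) auto
  also have "\<dots> = of_nat (card {i. i < n \<and> n - 1 - i = i})"
    by (simp add: sum.If_cases Int_def)
  also have "{i. i < n \<and> n - 1 - i = i} = (if odd n then {n div 2} else {})"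
  proof -
    have "i < n \<and> n - 1 - i = i \<longleftrightarrow> odd n \<and> i = n div 2" for i by presburger
    then show ?thesis by auto
  qed
  also have "of_nat (card (if odd n then {n div 2} else {})) = complex_of_real (if odd n then 1 else 0)"
    by simp
  finally have "(\<Sum>j<n. sgn (d j)) = (if odd n then 1 else 0)" by (simp only: of_real_eq_iff)
  also have "(\<Sum>j<n. sgn (d j)) = (\<Sum>j\<in>?P. sgn (d j)) + (\<Sum>j\<in>?Q. sgn (d j))"
    unfolding split(1) by (intro sum.union_disjoint split(2)) auto
  also have "\<dots> = real (card ?P) - real (card ?Q)" by simp
  finally have "card ?P = card ?Q + (if odd n then 1 else 0)"
    by (simp split: if_splits)
  with sum show "card ?P = (n + 1) div 2" "card ?Q = n div 2"
    by (auto split: if_splits)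
qed

text \<open>The grid consists of preimages under f of the |d j|, the sorted positive class at odd
  indices and the sorted negative class at even ones. A single grid satisfies the estimate for every
  \<delta>, so \<delta> may shrink afterwards.\<close>

lemma grid_exists:
  assumes C: "\<And>\<delta>. \<delta> > 0 \<Longrightarrow> location_bound \<delta> (C \<delta>)"
    and n: "n \<ge> 1"
  shows "\<exists>x. (\<forall>i\<in>{1..n}. x i \<in> {0..pi}) \<and>
    (\<forall>\<delta>>0. \<forall>i\<in>{1..n}. \<bar>x i - real i * (pi / real n)\<bar> \<le> \<delta> + (C \<delta> + pi) / real n) \<and>
    (\<exists>lamT lamH.
       eigenvalue_ordering (toeplitz_mat n (\<lambda>x. complex_of_real (f x))) lamT \<and>
       eigenvalue_ordering (hankel_mat n (\<lambda>x. complex_of_real (f x))) lamH \<and>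
       (\<forall>i\<in>{1..n}. lamT i = complex_of_real (f (x i)) \<and> lamH i = (- 1) ^ (i + 1) * lamT i))"
proof -
  obtain u :: "nat \<Rightarrow> nat \<Rightarrow> complex" and d :: "nat \<Rightarrow> real" where u: "orthonormal_on n {..<n} u"
    and d: "\<And>j. j < n \<Longrightarrow> d j \<noteq> 0"
    and eigT: "\<And>j i. j < n \<Longrightarrow> i < n \<Longrightarrow> (\<Sum>k<n. c (int i - int k) * u j k) = of_real \<bar>d j\<bar> * u j i"
    and flip: "\<And>j i. j < n \<Longrightarrow> i < n \<Longrightarrow> u j (n - 1 - i) = of_real (sgn (d j)) * u j i"
    and eigH: "\<And>j i. j < n \<Longrightarrow> i < n \<Longrightarrow>
      (\<Sum>k<n. c (int (n - 1 - i) - int k) * u j k) = of_real (d j) * u j i"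
    and d_bounds: "\<And>j. j < n \<Longrightarrow> \<bar>d j\<bar> \<in> {f 0..f pi}"
    using spectral_decomposition[of n] by blast
  define T where "T = toeplitz_mat n (\<lambda>x. complex_of_real (f x))"
  define H where "H = hankel_mat n (\<lambda>x. complex_of_real (f x))"
  have T: "T \<in> carrier_mat n n" "\<And>i k. i < n \<Longrightarrow> k < n \<Longrightarrow> T $$ (i, k) = c (int i - int k)"
    by (auto simp: T_def toeplitz_mat_def c_def)
  have H: "H \<in> carrier_mat n n" "\<And>i k. i < n \<Longrightarrow> k < n \<Longrightarrow> H $$ (i, k) = c (int (n - 1 - i) - int k)"
  proof -
    show "H \<in> carrier_mat n n"
      unfolding H_def hankel_mat_def
      by (rule mult_carrier_mat[of _ n n]) (simp_all add: flip_mat_def toeplitz_mat_def)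
    fix i k assume ik: "i < n" "k < n"
    have "H $$ (i, k) = (\<Sum>l<n. (if l = n - 1 - i then 1 else 0) * c (int l - int k))"
      using ik by (auto simp: H_def hankel_mat_def flip_mat_def toeplitz_mat_def scalar_prod_def
          lessThan_atLeast0 c_def intro!: sum.cong)
    also have "\<dots> = (\<Sum>l<n. if l = n - 1 - i then c (int l - int k) else 0)"
      by (intro sum.cong) auto
    also have "\<dots> = c (int (n - 1 - i) - int k)" using ik by (subst sum.delta) auto
    finally show "H $$ (i, k) = c (int (n - 1 - i) - int k)" .
  qed
  have prootsT: "proots (char_poly T) = image_mset (\<lambda>j. of_real \<bar>d j\<bar>) (mset_set {..<n})"
    by (rule proots_char_poly_orthonormal_eigenbasis[OF T(1) u]) (use eigT in \<open>simp add: T(2)\<close>)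
  have prootsH: "proots (char_poly H) = image_mset (\<lambda>j. of_real (d j)) (mset_set {..<n})"
    by (rule proots_char_poly_orthonormal_eigenbasis[OF H(1) u]) (use eigH in \<open>simp add: H(2)\<close>)
  define J where "J b = {j. j < n \<and> (if b then d j > 0 else d j < 0)}" for b
  have card_J: "card (J True) = (n + 1) div 2" "card (J False) = n div 2"
    using card_sign_classes[of n u d, OF u d flip] by (simp_all add: J_def)
  have J_sub: "J b \<subseteq> {..<n}" for b by (auto simp: J_def)
  have fin_J: "finite (J b)" for b using J_sub finite_subset by blast
  have sgn_J: "sgn (d j) = (if b then 1 else - 1)" if "j \<in> J b" for j b
    using that by (auto simp: J_def split: if_splits)
  have fam: "eigenfamily n (if b then 1 else - 1) (J b) u (\<lambda>j. \<bar>d j\<bar>)" for b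
    unfolding eigenfamily_def
  proof (intro conjI ballI allI impI fin_J orthonormal_on_subset[OF u J_sub])
    fix j i assume ji: "j \<in> J b" "i < n"
    then have "j < n" using J_sub by blast
    from flip[OF this ji(2)] sgn_J[OF ji(1)]
    show "u j (n - 1 - i) = (if b then 1 else - 1) * u j i" by (auto split: if_splits)
    show "(\<Sum>k<n. c (int i - int k) * u j k) = of_real \<bar>d j\<bar> * u j i"
      by (rule eigT[OF \<open>j < n\<close> ji(2)])
  qed
  have "\<exists>g. bij_betw g {1..card (J b)} (J b) \<and> mono_on {1..card (J b)} (\<lambda>i. \<bar>d (g i)\<bar>)" for b
    by (rule sorted_enumeration[OF fin_J])
  then obtain g where g: "\<And>b. bij_betw (g b) {1..card (J b)} (J b)"
    and g_mono: "\<And>b. mono_on {1..card (J b)} (\<lambda>i. \<bar>d (g b i)\<bar>)"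
    by metis
  \<comment> \<open>The position inside the class: i = 2 h - 1 for odd and i = 2 h for even
    i.\<close>
  define h where "h i = (i + 1) div 2" for i :: nat
  define \<sigma> where "\<sigma> i = g (odd i) (h i)" for i
  have h_range: "h i \<in> {1..card (J (odd i))}" if "i \<in> {1..n}" for i
  proof -
    have "1 \<le> h i" "h i \<le> (if odd i then (n + 1) div 2 else n div 2)"
      using that unfolding h_def atLeastAtMost_iff by presburger+
    then show ?thesis by (simp add: card_J split: if_splits)
  qed
  have \<sigma>_J: "\<sigma> i \<in> J (odd i)" if "i \<in> {1..n}" for i
    using bij_betwE[OF g] h_range[OF that] unfolding \<sigma>_def by blast
  \<comment> \<open>The sign of \<open>d (\<sigma> i)\<close> reveals the parity of
    \<open>i\<close>, and \<open>g\<close> is injective inside a class; surjectivity then follows by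
    cardinality.\<close>
  have "inj_on \<sigma> {1..n}"
  proof (rule inj_onI)
    fix i i' assume ii: "i \<in> {1..n}" "i' \<in> {1..n}" and eq: "\<sigma> i = \<sigma> i'"
    have par: "odd i = odd i'"
      using \<sigma>_J[OF ii(1)] \<sigma>_J[OF ii(2)] eq by (auto simp: J_def split: if_splits)
    have "g (odd i) (h i) = g (odd i) (h i')" using eq unfolding \<sigma>_def par .
    then have "h i = h i'"
      by (rule inj_onD[OF bij_betw_imp_inj_on[OF g] _ h_range[OF ii(1)] h_range[OF ii(2), folded par]])
    with par show "i = i'" unfolding h_def by presburger
  qed
  moreover have "\<sigma> ` {1..n} \<subseteq> {..<n}" using \<sigma>_J J_sub by blast
  ultimately have \<sigma>: "inj_on \<sigma> {1..n}" "\<sigma> ` {1..n} = {..<n}"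
    using card_image[of \<sigma> "{1..n}"] card_subset_eq[of "{..<n}" "\<sigma> ` {1..n}"] by auto
  have "\<exists>t\<in>{0..pi}. f t = \<bar>d (\<sigma> i)\<bar>" if "i \<in> {1..n}" for i
  proof -
    have "\<sigma> i < n" using \<sigma>(2) that by blast
    with d_bounds have "\<exists>t. 0 \<le> t \<and> t \<le> pi \<and> f t = \<bar>d (\<sigma> i)\<bar>"
      by (intro IVT' cont0) auto
    then show ?thesis by auto
  qed
  then obtain x where x: "\<And>i. i \<in> {1..n} \<Longrightarrow> x i \<in> {0..pi}"
    "\<And>i. i \<in> {1..n} \<Longrightarrow> f (x i) = \<bar>d (\<sigma> i)\<bar>"
    by metis
  have n0: "real n > 0" using n by simp
  have close: "\<bar>x i - real i * (pi / real n)\<bar> \<le> \<delta> + (C \<delta> + pi) / real n"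
    if i: "i \<in> {1..n}" and "\<delta> > 0" for i \<delta>
  proof -
    have "\<bar>x i - 2 * pi * real (h i) / real n\<bar> \<le> \<delta> + C \<delta> / real n"
    proof -
      have "n \<le> 2 * card (J (odd i)) + 1 \<and> 2 * card (J (odd i)) \<le> n + 1"
        by (cases "odd i"; simp add: card_J; presburger)
      moreover have "f (x i) = \<bar>d (g (odd i) (h i))\<bar>" using x(2)[OF i] by (simp add: \<sigma>_def)
      ultimately show ?thesis
        using C[OF \<open>\<delta> > 0\<close>, unfolded location_bound_def, rule_format,
            OF n fam g g_mono _ _ h_range[OF i] x(1)[OF i]] by blast
    qed
    \<comment> \<open>Interleaving moves the target by at most pi / n, because 2 h - i is 1 for odd
      and 0 for even i.\<close>
    moreover have "\<bar>2 * pi * real (h i) / real n - real i * (pi / real n)\<bar> \<le> pi / real n"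
    proof -
      have "\<bar>2 * real (h i) - real i\<bar> \<le> 1" unfolding h_def by (cases "odd i") (auto elim!: evenE oddE)
      then have "pi * \<bar>2 * real (h i) - real i\<bar> \<le> pi * 1" by (intro mult_left_mono) auto
      moreover have "2 * pi * real (h i) / real n - real i * (pi / real n) =
          pi * (2 * real (h i) - real i) / real n"
        by (simp add: diff_divide_distrib algebra_simps)
      ultimately show ?thesis using n0 by (simp add: abs_mult divide_right_mono)
    qed
    ultimately show ?thesis unfolding add_divide_distrib by linarith
  qed
  have orderings: "eigenvalue_ordering T (\<lambda>i. of_real \<bar>d (\<sigma> i)\<bar>)"
    "eigenvalue_ordering H (\<lambda>i. of_real (d (\<sigma> i)))"
  proof -
    have "image_mset \<sigma> (mset_set {1..n}) = mset_set {..<n}"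
      using image_mset_mset_set[OF \<sigma>(1)] \<sigma>(2) by simp
    then have "image_mset (\<lambda>i. F (\<sigma> i)) (mset_set {1..n}) = image_mset F (mset_set {..<n})"
      for F :: "nat \<Rightarrow> complex"
      by (metis (no_types, lifting) image_mset.compositionality comp_def image_mset_cong)
    then show "eigenvalue_ordering T (\<lambda>i. of_real \<bar>d (\<sigma> i)\<bar>)" "eigenvalue_ordering H (\<lambda>i. of_real (d (\<sigma> i)))"
      using T(1) H(1) by (simp_all add: eigenvalue_ordering_def prootsT prootsH)
  qed
  have signs: "complex_of_real (d (\<sigma> i)) = (- 1) ^ (i + 1) * of_real \<bar>d (\<sigma> i)\<bar>" if "i \<in> {1..n}" for i
  proof -
    have "d (\<sigma> i) = sgn (d (\<sigma> i)) * \<bar>d (\<sigma> i)\<bar>" by (simp add: sgn_mult_abs)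
    also have "sgn (d (\<sigma> i)) = (- 1) ^ (i + 1)" using sgn_J[OF \<sigma>_J[OF that]] by simp
    finally have "complex_of_real (d (\<sigma> i)) = of_real ((- 1) ^ (i + 1) * \<bar>d (\<sigma> i)\<bar>)" by (rule arg_cong)
    then show ?thesis by (simp only: of_real_mult of_real_power of_real_minus of_real_1)
  qed
  have "\<forall>i\<in>{1..n}. complex_of_real \<bar>d (\<sigma> i)\<bar> = of_real (f (x i)) \<and>
      complex_of_real (d (\<sigma> i)) = (- 1) ^ (i + 1) * of_real \<bar>d (\<sigma> i)\<bar>"
    using x(2) signs by metis
  with orderings x(1) close show ?thesis unfolding T_def H_def by blast
qed

text \<open>The grids are fixed for all n first. For a tolerance r the estimate is then used with
  \<delta> = r / 2, and n is taken so large that the term divided by n is below r / 2.\<close>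

lemma uniform_grid_exists:
  "\<exists>xi. asymptotically_uniform_grid 0 pi xi \<and>
    (\<forall>n\<ge>1. \<exists>lamT lamH.
       eigenvalue_ordering (toeplitz_mat n (\<lambda>x. complex_of_real (f x))) lamT \<and>
       eigenvalue_ordering (hankel_mat n (\<lambda>x. complex_of_real (f x))) lamH \<and>
       (\<forall>i\<in>{1..n}. lamT i = complex_of_real (f (xi n i)) \<and> lamH i = (- 1) ^ (i + 1) * lamT i))"
proof -
  have "\<forall>\<delta>\<in>{0<..}. \<exists>C. location_bound \<delta> C" using eigenvalue_location by simp
  then obtain C where "\<forall>\<delta>\<in>{0<..}. location_bound \<delta> (C \<delta>)" by (rule bchoice[THEN exE])
  then have C: "location_bound \<delta> (C \<delta>)" if "\<delta> > 0" for \<delta> using that by simp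
  define good where "good n x \<longleftrightarrow> (\<forall>i\<in>{1..n}. x i \<in> {0..pi}) \<and>
    (\<forall>\<delta>>0. \<forall>i\<in>{1..n}. \<bar>x i - real i * (pi / real n)\<bar> \<le> \<delta> + (C \<delta> + pi) / real n) \<and>
    (\<exists>lamT lamH.
       eigenvalue_ordering (toeplitz_mat n (\<lambda>x. complex_of_real (f x))) lamT \<and>
       eigenvalue_ordering (hankel_mat n (\<lambda>x. complex_of_real (f x))) lamH \<and>
       (\<forall>i\<in>{1..n}. lamT i = complex_of_real (f (x i)) \<and> lamH i = (- 1) ^ (i + 1) * lamT i))"
    for n and x :: "nat \<Rightarrow> real"
  have "\<forall>n\<in>{1..}. \<exists>x. good n x" unfolding good_def using grid_exists[OF C] by simp
  then obtain xi where "\<forall>n\<in>{1..}. good n (xi n)" by (rule bchoice[THEN exE])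
  then have good: "good n (xi n)" if "n \<ge> 1" for n using that by simp
  have xi: "\<forall>n\<ge>1. \<forall>i\<in>{1..n}. xi n i \<in> {0..pi}"
    and close: "\<And>n i \<delta>. n \<ge> 1 \<Longrightarrow> i \<in> {1..n} \<Longrightarrow> \<delta> > 0 \<Longrightarrow>
      \<bar>xi n i - real i * (pi / real n)\<bar> \<le> \<delta> + (C \<delta> + pi) / real n"
    and eigs: "\<forall>n\<ge>1. \<exists>lamT lamH.
       eigenvalue_ordering (toeplitz_mat n (\<lambda>x. complex_of_real (f x))) lamT \<and>
       eigenvalue_ordering (hankel_mat n (\<lambda>x. complex_of_real (f x))) lamH \<and>
       (\<forall>i\<in>{1..n}. lamT i = complex_of_real (f (xi n i)) \<and> lamH i = (- 1) ^ (i + 1) * lamT i)"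
    using good unfolding good_def by (blast, blast, blast)
  have "(\<lambda>n. MAX i\<in>{1..n}. \<bar>xi n i - (0 + real i * ((pi - 0) / real n))\<bar>) \<longlonglongrightarrow> 0"
  proof (rule LIMSEQ_I)
    fix r :: real assume "r > 0"
    obtain n0 :: nat where n0: "2 * (C (r / 2) + pi) / r < real n0" using reals_Archimedean2 by blast
    show "\<exists>no. \<forall>n\<ge>no. norm ((MAX i\<in>{1..n}. \<bar>xi n i - (0 + real i * ((pi - 0) / real n))\<bar>) - 0) < r"
    \<comment> \<open>The 1 keeps the index set nonempty, so that \<open>Max\<close> is one of the
      deviations.\<close>
    proof (intro exI[of _ "max 1 n0"] allI impI)
      fix n assume n: "max 1 n0 \<le> n"
      let ?S = "(\<lambda>i. \<bar>xi n i - (0 + real i * ((pi - 0) / real n))\<bar>) ` {1..n}"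
      have "2 * (C (r / 2) + pi) < r * real n"
      proof -
        have "2 * (C (r / 2) + pi) < r * real n0" using n0 \<open>r > 0\<close> by (simp add: divide_less_eq mult.commute)
        also have "\<dots> \<le> r * real n" using n \<open>r > 0\<close> by (intro mult_left_mono) auto
        finally show ?thesis .
      qed
      then have bound: "(C (r / 2) + pi) / real n < r / 2" using n by (simp add: field_simps)
      have "s < r \<and> 0 \<le> s" if "s \<in> ?S" for s
      proof -
        from that obtain i where i: "s = \<bar>xi n i - (0 + real i * ((pi - 0) / real n))\<bar>" "i \<in> {1..n}"
          by (rule imageE)
        have "s \<le> r / 2 + (C (r / 2) + pi) / real n"
          unfolding i(1) using close[of n i "r / 2"] n i(2) \<open>r > 0\<close> by simp
        also have "\<dots> < r / 2 + r / 2" using bound by (rule add_strict_left_mono)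
        finally show ?thesis by (simp add: i(1))
      qed
      moreover have "Max ?S \<in> ?S" using n by (intro Max_in) auto
      ultimately have "Max ?S < r \<and> 0 \<le> Max ?S" by blast
      then show "norm (Max ?S - 0) < r" by (simp only: real_norm_def diff_0_right abs_of_nonneg)
    qed
  qed
  with xi have "asymptotically_uniform_grid 0 pi xi"
    unfolding asymptotically_uniform_grid_def by blast
  with eigs show ?thesis by blast
qed

end

theorem theorem7:
  fixes f :: "real \<Rightarrow> real"
  assumes "continuous_on {-pi..pi} f"
    and "\<forall>x\<in>{-pi..pi}. f (- x) = f x"
    and "\<forall>x\<in>{0..pi}. f x > 0"
    and "strict_mono_on {0..pi} f"
  shows "\<exists>xi :: nat \<Rightarrow> nat \<Rightarrow> real. asymptotically_uniform_grid 0 pi xi \<and>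
    (\<forall>n\<ge>1. \<exists>lamT lamH :: nat \<Rightarrow> complex.
       eigenvalue_ordering (toeplitz_mat n (\<lambda>x. complex_of_real (f x))) lamT \<and>
       eigenvalue_ordering (hankel_mat n (\<lambda>x. complex_of_real (f x))) lamH \<and>
       (\<forall>i\<in>{1..n}. lamT i = complex_of_real (f (xi n i)) \<and>
                    lamH i = (- 1) ^ (i + 1) * lamT i))"
proof -
  have "toeplitz_symbol f"
    by (rule toeplitz_symbol.intro[OF assms(1) bspec[OF assms(2)] bspec[OF assms(3)] assms(4)])
  then show ?thesis by (rule toeplitz_symbol.uniform_grid_exists)
qed

end
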